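(* Let $X$ and $Y$ be measurable spaces and let $\nu$ be a kernel from $X$ to $Y$. Each of the following two conditions is equivalent to $\nu$ being s-finite: 1. $\nu=\sum_{n\in\mathbb{N}}\nu_n$ for some subprobability kernels $\nu_n$ from $X$ to $Y$; 2. $\nu$ is the pushforward of a $\sigma$-finite kernel, i.e. there are a measurable space $W$, a $\sigma$-finite kernel $\mu$ from $X$ to $W$ and a measurable function $h:W\to Y$ with $\nu=h_*\mu$. Moreover: 3. for any measurable $f:X\times Y\to[0,\infty]$, $\nu\triangleright f$ is an s-finite kernel if $\nu$ is an s-finite kernel; in particular, $\nu\triangleright f$ is s-finite if $\nu$ is a subprobability kernel; 4. if $\nu$ is an s-finite kernel, then there exist a subprobability kernel $\mu$ from $X$ to $Y$ and a function $f:X\times Y\to[0,\infty]$, with $f(x,-)$ measurable for all $x\in X$, such that $\nu=\mu\triangleright f$ and $\mu(x,\{y\in Y\mid f(x,y)=0\})=0$ for all $x\in X$ (so we may choose $f>0$). If either $X$ is countable and discrete or $Y$ is standard Borel, then $f$ can be taken to be jointly measurable on $X\times Y$.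
   Context: A kernel from a measurable space $X$ to a measurable space $Y$ is a map $k:X\times\Sigma_Y\to[0,\infty]$ that is measurable in its first argument and a measure in its second. It is a subprobability kernel if $\sup_{x}k(x,Y)\le 1$; finite if $\sup_{x\in X}k(x,Y)<\infty$; s-finite if $k=\sum_{i\in\mathbb{N}}k_i$ with each $k_i$ a finite kernel from $X$ to $Y$; $\sigma$-finite if moreover the $k_i$ can be chosen pairwise mutually singular. For $C\in\Sigma_{X\times Y}$ write $C^x=\{y\mid (x,y)\in C\}$; $k$ is supported in $C$ if $k(x,Y\setminus C^x)=0$ for all $x$. Kernels $k,l$ from $X$ to $Y$ are mutually singular if there is $A\in\Sigma_{X\times Y}$ such that $k$ is supported in $A$ and $l$ is supported in $(X\times Y)\setminus A$. For a kernel $k$ from $X$ to $Y$ and $f:X\times Y\to[0,\infty]$ with each $f(x,-)$ measurable, $(k\triangleright f)(x,V):=\int_V k(x,\mathrm{d}y)\,f(x,y)$. For a kernel $\mu$ from $X$ to $W$ and measurable $h:W\to Y$, $(h_*\mu)(x,V):=\mu(x,h^{-1}(V))$. Convention: $\infty\cdot 0=0$. A countable discrete space carries the $\sigma$-algebra of all subsets; a standard Borel space is a set with the Borel $\sigma$-algebra of some complete separable metric. *)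

theory Defs
  imports "HOL-Analysis.Analysis"
begin

text \<open>
  A kernel is a function into \<^typ>\<open>'b measure\<close>, required to be a kernel only on \<^term>\<open>space X\<close>.
  The Giry-monad rendering through \<open>subprob_algebra\<close> is not used: it excludes infinite kernels and
  requires a nonempty target space.
\<close>

definition is_kernel :: "'a measure \<Rightarrow> 'b measure \<Rightarrow> ('a \<Rightarrow> 'b measure) \<Rightarrow> bool" where
  "is_kernel X Y k \<longleftrightarrow>
     (\<forall>x\<in>space X. sets (k x) = sets Y) \<and>
     (\<forall>V\<in>sets Y. (\<lambda>x. emeasure (k x) V) \<in> borel_measurable X)"

text \<open>Values outside \<^term>\<open>space X\<close> are junk, so equality of kernels is equality on \<^term>\<open>space X\<close>.\<close>

definition kernel_eq :: "'a measure \<Rightarrow> ('a \<Rightarrow> 'b measure) \<Rightarrow> ('a \<Rightarrow> 'b measure) \<Rightarrow> bool" where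
  "kernel_eq X k l \<longleftrightarrow> (\<forall>x\<in>space X. k x = l x)"

definition subprob_kernel :: "'a measure \<Rightarrow> 'b measure \<Rightarrow> ('a \<Rightarrow> 'b measure) \<Rightarrow> bool" where
  "subprob_kernel X Y k \<longleftrightarrow> is_kernel X Y k \<and> (SUP x\<in>space X. emeasure (k x) (space Y)) \<le> 1"

definition finite_kernel :: "'a measure \<Rightarrow> 'b measure \<Rightarrow> ('a \<Rightarrow> 'b measure) \<Rightarrow> bool" where
  "finite_kernel X Y k \<longleftrightarrow> is_kernel X Y k \<and> (SUP x\<in>space X. emeasure (k x) (space Y)) < \<infinity>"

definition is_kernel_sum ::
    "'a measure \<Rightarrow> 'b measure \<Rightarrow> ('a \<Rightarrow> 'b measure) \<Rightarrow> (nat \<Rightarrow> 'a \<Rightarrow> 'b measure) \<Rightarrow> bool" where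
  "is_kernel_sum X Y k ks \<longleftrightarrow>
     (\<forall>x\<in>space X. \<forall>V\<in>sets Y. emeasure (k x) V = (\<Sum>i. emeasure (ks i x) V))"

definition supported_in ::
    "'a measure \<Rightarrow> 'b measure \<Rightarrow> ('a \<Rightarrow> 'b measure) \<Rightarrow> ('a \<times> 'b) set \<Rightarrow> bool" where
  "supported_in X Y k C \<longleftrightarrow> (\<forall>x\<in>space X. emeasure (k x) (space Y - {y. (x, y) \<in> C}) = 0)"

definition mutually_singular ::
    "'a measure \<Rightarrow> 'b measure \<Rightarrow> ('a \<Rightarrow> 'b measure) \<Rightarrow> ('a \<Rightarrow> 'b measure) \<Rightarrow> bool" where
  "mutually_singular X Y k l \<longleftrightarrow>
     (\<exists>A\<in>sets (X \<Otimes>\<^sub>M Y). supported_in X Y k A \<and>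
        supported_in X Y l (space X \<times> space Y - A))"

definition s_finite_kernel :: "'a measure \<Rightarrow> 'b measure \<Rightarrow> ('a \<Rightarrow> 'b measure) \<Rightarrow> bool" where
  "s_finite_kernel X Y k \<longleftrightarrow> is_kernel X Y k \<and>
     (\<exists>ks. (\<forall>i. finite_kernel X Y (ks i)) \<and> is_kernel_sum X Y k ks)"

definition sigma_finite_kernel :: "'a measure \<Rightarrow> 'b measure \<Rightarrow> ('a \<Rightarrow> 'b measure) \<Rightarrow> bool" where
  "sigma_finite_kernel X Y k \<longleftrightarrow> is_kernel X Y k \<and>
     (\<exists>ks. (\<forall>i. finite_kernel X Y (ks i)) \<and> is_kernel_sum X Y k ks \<and>
        (\<forall>i j. i \<noteq> j \<longrightarrow> mutually_singular X Y (ks i) (ks j)))"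

text \<open>
  \<^const>\<open>density\<close> and \<^const>\<open>distr\<close> carry the intended values only for measurable sections
  \<^term>\<open>\<lambda>y. f (x, y)\<close> and measurable \<^term>\<open>h\<close>; all uses below assume this.
  Multiplication on \<^typ>\<open>ennreal\<close> satisfies \<^term>\<open>\<infinity> * 0 = (0::ennreal)\<close>.
\<close>

definition kernel_density :: "('a \<Rightarrow> 'b measure) \<Rightarrow> ('a \<times> 'b \<Rightarrow> ennreal) \<Rightarrow> 'a \<Rightarrow> 'b measure" where
  "kernel_density k f = (\<lambda>x. density (k x) (\<lambda>y. f (x, y)))"

definition kernel_pushforward ::
    "'b measure \<Rightarrow> ('w \<Rightarrow> 'b) \<Rightarrow> ('a \<Rightarrow> 'w measure) \<Rightarrow> 'a \<Rightarrow> 'b measure" where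
  "kernel_pushforward Y h \<mu> = (\<lambda>x. distr (\<mu> x) Y h)"

text \<open>The measurable space \<^term>\<open>W\<close> is a parameter, as types cannot be quantified existentially.\<close>

definition pushforward_of_sigma_finite ::
    "'w measure \<Rightarrow> 'a measure \<Rightarrow> 'b measure \<Rightarrow> ('a \<Rightarrow> 'b measure) \<Rightarrow> bool" where
  "pushforward_of_sigma_finite W X Y \<nu> \<longleftrightarrow>
     (\<exists>\<mu> h. sigma_finite_kernel X W \<mu> \<and> h \<in> measurable W Y \<and>
        kernel_eq X \<nu> (kernel_pushforward Y h \<mu>))"

definition countable_discrete :: "'a measure \<Rightarrow> bool" where
  "countable_discrete X \<longleftrightarrow> countable (space X) \<and> sets X = Pow (space X)"

definition standard_borel :: "'b measure \<Rightarrow> bool" where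
  "standard_borel Y \<longleftrightarrow>
     (\<exists>m. mspace m = space Y \<and> mcomplete_of m \<and> separable_space (mtopology_of m) \<and>
        sets Y = sigma_sets (space Y) {U. openin (mtopology_of m) U})"

end

theory Submission
  imports Defs "HOL-Probability.Giry_Monad"
begin

text \<open>
  A finite kernel is a finite sum of copies of a scaled-down subprobability kernel, so every s-finite
  kernel is a countable sum of subprobability kernels \<open>\<nu>\<^sub>n\<close>. Placing \<open>\<nu>\<^sub>n\<close> on the \<open>n\<close>-th copy of \<open>Y\<close>
  in \<open>\<nat> \<times> Y\<close> makes the summands mutually singular, and the projection to \<open>Y\<close> recovers \<open>\<nu>\<close>.
  The subprobability kernel \<open>\<mu> = \<Sum>n. 2\<^bsup>-n-1\<^esup> \<nu>\<^sub>n\<close> has the same null sets as \<open>\<nu>\<close>, and Radon--Nikodym applied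
  at each \<open>x\<close> gives \<open>f\<close>. If \<open>Y\<close> is standard Borel, the derivatives of the dominated kernels
  \<open>2\<^bsup>-n-1\<^esup> \<nu>\<^sub>n \<le> \<mu>\<close> are limits of measurably selected elements of a countable \<open>L\<^sup>2\<close>-dense family, hence
  have jointly measurable versions.
\<close>

section \<open>Sums of measures and kernels\<close>

text \<open>The obstacle is measurability in x: Radon-Nikodym chooses a derivative for each x
  separately, and nothing ties these choices together. Over a countable discrete X this is harmless;
  over a standard Borel Y a countable generator allows selection in place of choice. The selection
  takes place in L^2, whereas \<open>\<nu> x\<close> can be so infinite that its derivative takes
  the value \<open>\<infinity>\<close> on a set of positive measure. It is therefore applied to
  pieces dominated by the finite measure \<open>\<mu> x\<close>, whose derivatives lie in [0,1], and
  the derivative of \<open>\<nu> x\<close> is their sum with weights 2^(n+1). The two halves of the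
  equality of null sets serve different ends: that \<open>\<nu>\<close> vanishes where
  \<open>\<mu>\<close> does is the absolute continuity needed for a derivative f, and the converse
  makes the zero set of f a null set of \<open>\<mu>\<close>.\<close>

lemma is_kernel_sets: "is_kernel X Y k \<Longrightarrow> x \<in> space X \<Longrightarrow> sets (k x) = sets Y"
  by (simp add: is_kernel_def)

lemma is_kernel_space: "is_kernel X Y k \<Longrightarrow> x \<in> space X \<Longrightarrow> space (k x) = space Y"
  by (meson is_kernel_sets sets_eq_imp_space_eq)

lemma is_kernel_measurable_emeasure:
  "is_kernel X Y k \<Longrightarrow> V \<in> sets Y \<Longrightarrow> (\<lambda>x. emeasure (k x) V) \<in> borel_measurable X"
  by (simp add: is_kernel_def)

lemma subprob_kernel_iff:
  "subprob_kernel X Y k \<longleftrightarrow>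
     is_kernel X Y k \<and> (\<forall>x\<in>space X. emeasure (k x) (space Y) \<le> 1)"
  by (simp add: subprob_kernel_def SUP_le_iff)

text \<open>The bound is taken in the natural numbers because it determines how many scaled copies a
  finite kernel is split into.\<close>

lemma finite_kernel_iff:
  "finite_kernel X Y k \<longleftrightarrow>
     is_kernel X Y k \<and> (\<exists>n::nat. \<forall>x\<in>space X. emeasure (k x) (space Y) \<le> of_nat n)"
proof safe
  assume k: "finite_kernel X Y k"
  then show "is_kernel X Y k"
    by (simp add: finite_kernel_def)
  obtain n :: nat where "(SUP x\<in>space X. emeasure (k x) (space Y)) < of_nat n"
    using k ennreal_Ex_less_of_nat by (auto simp: finite_kernel_def)
  then show "\<exists>n::nat. \<forall>x\<in>space X. emeasure (k x) (space Y) \<le> of_nat n"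
    by (meson SUP_upper dual_order.trans less_imp_le)
next
  fix n :: nat assume "is_kernel X Y k" "\<forall>x\<in>space X. emeasure (k x) (space Y) \<le> of_nat n"
  moreover from this have "(SUP x\<in>space X. emeasure (k x) (space Y)) \<le> of_nat n"
    by (intro SUP_least) auto
  ultimately show "finite_kernel X Y k"
    by (auto simp: finite_kernel_def of_nat_less_top intro: le_less_trans)
qed

lemma subprob_kernel_finite: "subprob_kernel X Y k \<Longrightarrow> finite_kernel X Y k"
  by (auto simp: subprob_kernel_iff finite_kernel_iff intro!: exI[of _ 1])

lemma subprob_kernel_subprob_space:
  assumes "subprob_kernel X Y k" "x \<in> space X" "space Y \<noteq> {}"
  shows "subprob_space (k x)"
  using assms is_kernel_space[of X Y k x] by (auto simp: subprob_kernel_iff intro!: subprob_spaceI)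

text \<open>Derived from the mass bound directly, since \<open>subprob_space\<close> excludes an
  empty space.\<close>

lemma subprob_kernel_finite_measure:
  assumes "subprob_kernel X Y k" "x \<in> space X"
  shows "finite_measure (k x)"
proof (rule finite_measureI)
  have "emeasure (k x) (space (k x)) \<le> 1"
    using assms is_kernel_space[of X Y k x] by (auto simp: subprob_kernel_iff)
  then show "emeasure (k x) (space (k x)) \<noteq> \<infinity>"
    by (auto simp: top_unique)
qed

section \<open>Interchange of countable sums, and countable sums of measures\<close>

lemma ennreal_suminf_commute:
  fixes f :: "nat \<Rightarrow> nat \<Rightarrow> ennreal"
  shows "(\<Sum>i. \<Sum>j. f i j) = (\<Sum>j. \<Sum>i. f i j)"
  using nn_integral_suminf[of "\<lambda>j i. f i j" "count_space UNIV"]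
  by (simp add: nn_integral_count_space_nat)

lemma ennreal_suminf_prod_decode:
  fixes f :: "nat \<Rightarrow> nat \<Rightarrow> ennreal"
  shows "(\<Sum>n. case prod_decode n of (i, j) \<Rightarrow> f i j) = (\<Sum>i. \<Sum>j. f i j)"
  by (subst suminf_ennreal_2dimen[of "\<lambda>i. \<Sum>j. f i j" "\<lambda>(i, j). f i j"]) auto

text \<open>\<open>is_kernel_sum\<close> compares a given kernel with a family; this supplies the
  kernel when only the family is at hand.\<close>

definition sum_measure :: "'b measure \<Rightarrow> (nat \<Rightarrow> 'b measure) \<Rightarrow> 'b measure" where
  "sum_measure Y ms = measure_of (space Y) (sets Y) (\<lambda>V. \<Sum>i. emeasure (ms i) V)"

lemma sets_sum_measure [simp, measurable_cong]: "sets (sum_measure Y ms) = sets Y"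
  by (simp add: sum_measure_def)

lemma emeasure_sum_measure:
  assumes "\<And>i. sets (ms i) = sets Y" "V \<in> sets Y"
  shows "emeasure (sum_measure Y ms) V = (\<Sum>i. emeasure (ms i) V)"
  unfolding sum_measure_def
proof (rule emeasure_measure_of_sigma)
  show "countably_additive (sets Y) (\<lambda>V. \<Sum>i. emeasure (ms i) V)"
  proof (rule countably_additiveI)
    fix A :: "nat \<Rightarrow> 'a set" assume A: "range A \<subseteq> sets Y" "disjoint_family A"
    have "(\<Sum>i. \<Sum>j. emeasure (ms j) (A i)) = (\<Sum>j. \<Sum>i. emeasure (ms j) (A i))"
      by (rule ennreal_suminf_commute)
    also have "\<dots> = (\<Sum>j. emeasure (ms j) (\<Union>i. A i))"
      using A assms by (intro suminf_cong suminf_emeasure) auto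
    finally show "(\<Sum>i. \<Sum>j. emeasure (ms j) (A i)) = (\<Sum>j. emeasure (ms j) (\<Union>i. A i))" .
  qed
qed (auto simp: positive_def assms sets.sigma_algebra_axioms)

text \<open>Induction over nonnegative measurable functions. The content is in the monotone limit,
  where supremum and sum interchange because each summand increases along the sequence.\<close>

lemma nn_integral_measure_sum:
  assumes "\<And>i::nat. sets (ms i) = sets M"
    and sum: "\<And>V. V \<in> sets M \<Longrightarrow> emeasure M V = (\<Sum>i. emeasure (ms i) V)"
    and f: "f \<in> borel_measurable M"
  shows "(\<integral>\<^sup>+y. f y \<partial>M) = (\<Sum>i. \<integral>\<^sup>+y. f y \<partial>ms i)"
proof -
  note [measurable_cong] = assms(1)
  have space: "space (ms i) = space M" for i
    using assms(1) sets_eq_imp_space_eq by blast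
  show ?thesis
    using f
  proof (induction rule: borel_measurable_induct)
    case (cong f g)
    have "integral\<^sup>N M f = integral\<^sup>N M g" "\<And>i. integral\<^sup>N (ms i) f = integral\<^sup>N (ms i) g"
      using cong(3) by (auto intro!: nn_integral_cong simp: space)
    with cong show ?case by simp
  next
    case (set A)
    then show ?case by (simp add: sum assms(1))
  next
    case (mult u c)
    then show ?case by (simp add: nn_integral_cmult)
  next
    case (add u v)
    then show ?case by (simp add: nn_integral_add suminf_add)
  next
    case (seq U)
    note [measurable] = seq(1)
    have "(\<Sum>i. \<integral>\<^sup>+y. (SUP n. U n y) \<partial>ms i) = (\<Sum>i. SUP n. \<integral>\<^sup>+y. U n y \<partial>ms i)"
      by (intro suminf_cong nn_integral_monotone_convergence_SUP seq) measurable
    also have "\<dots> = (SUP n. \<Sum>i. \<integral>\<^sup>+y. U n y \<partial>ms i)"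
      using \<open>incseq U\<close>
      by (intro ennreal_suminf_SUP_eq) (auto intro!: nn_integral_mono simp: incseq_def le_fun_def)
    also have "\<dots> = (\<integral>\<^sup>+y. (SUP n. U n y) \<partial>M)"
      by (subst nn_integral_monotone_convergence_SUP) (simp_all add: seq)
    finally show ?case by (simp add: image_comp)
  qed
qed

lemma is_kernel_of_sum:
  assumes "\<And>x. x \<in> space X \<Longrightarrow> sets (k x) = sets Y"
    and "\<And>i. is_kernel X Y (ks i)" "is_kernel_sum X Y k ks"
  shows "is_kernel X Y k"
  unfolding is_kernel_def
proof (intro conjI ballI)
  fix V assume V: "V \<in> sets Y"
  have "(\<lambda>x. \<Sum>i. emeasure (ks i x) V) \<in> borel_measurable X"
    using assms(2) V by (intro borel_measurable_suminf_order) (auto simp: is_kernel_def)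
  then show "(\<lambda>x. emeasure (k x) V) \<in> borel_measurable X"
    by (rule measurable_cong[THEN iffD1, rotated])
      (use assms(3) V in \<open>auto simp: is_kernel_sum_def\<close>)
qed (rule assms)

section \<open>Splitting s-finite kernels into subprobability kernels\<close>

lemma is_kernel_scale:
  assumes "is_kernel X Y k"
  shows "is_kernel X Y (\<lambda>x. scale_measure r (k x))"
  using assms by (auto simp: is_kernel_def intro!: borel_measurable_times)

lemma finite_kernel_eq_sum_subprob:
  assumes "finite_kernel X Y k"
  shows "\<exists>ls. (\<forall>j. subprob_kernel X Y (ls j)) \<and> is_kernel_sum X Y k ls"
proof -
  obtain n :: nat where k: "is_kernel X Y k"
    and n: "\<And>x. x \<in> space X \<Longrightarrow> emeasure (k x) (space Y) \<le> of_nat n"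
    using assms by (auto simp: finite_kernel_iff)
  \<comment> \<open>\<open>Suc n\<close> in place of \<open>n\<close> keeps the copies adding up to
    the whole also when the bound is 0.\<close>
  define c :: ennreal where "c = ennreal (1 / real (Suc n))"
  have c: "of_nat (Suc n) * c = 1"
    unfolding c_def ennreal_of_nat_eq_real_of_nat by (subst ennreal_mult[symmetric]) simp_all
  \<comment> \<open>\<open>is_kernel_sum\<close> runs over all naturals, so the finite sum is padded
    with zero kernels.\<close>
  define ls where "ls j = (\<lambda>x. scale_measure (if j < Suc n then c else 0) (k x))" for j
  have "subprob_kernel X Y (ls j)" for j
    unfolding subprob_kernel_iff
  proof (intro conjI ballI)
    show "is_kernel X Y (ls j)"
      unfolding ls_def by (intro is_kernel_scale k)
    fix x assume x: "x \<in> space X"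
    have "c * emeasure (k x) (space Y) \<le> c * of_nat (Suc n)"
      by (intro mult_left_mono order_trans[OF n[OF x]]) auto
    also have "\<dots> = 1"
      using c by (simp only: mult.commute)
    finally show "emeasure (ls j x) (space Y) \<le> 1"
      by (simp add: ls_def)
  qed
  moreover have "is_kernel_sum X Y k ls"
    unfolding is_kernel_sum_def
  proof (intro ballI)
    fix x V
    have "(\<Sum>j. emeasure (ls j x) V) = (\<Sum>j<Suc n. emeasure (ls j x) V)"
      by (intro suminf_finite) (auto simp: ls_def)
    also have "\<dots> = of_nat (Suc n) * c * emeasure (k x) V"
      by (simp add: ls_def mult.assoc)
    finally show "emeasure (k x) V = (\<Sum>j. emeasure (ls j x) V)"
      by (simp only: c mult_1)
  qed
  ultimately show ?thesis by blast
qed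

text \<open>A double series of nonnegative terms may be enumerated along \<open>prod_decode\<close>.
  The pieces \<open>ks i\<close> may have infinite mass; densities rely on this, since an unbounded
  f can turn a subprobability kernel into an infinite one.\<close>

lemma sum_subprob_of_sum:
  assumes "is_kernel_sum X Y k ks"
    and "\<And>i. \<exists>ls. (\<forall>j. subprob_kernel X Y (ls j)) \<and> is_kernel_sum X Y (ks i) ls"
  shows "\<exists>\<nu>s. (\<forall>n. subprob_kernel X Y (\<nu>s n)) \<and> is_kernel_sum X Y k \<nu>s"
proof -
  obtain ls where ls: "\<And>i j. subprob_kernel X Y (ls i j)"
    "\<And>i. is_kernel_sum X Y (ks i) (ls i)"
    using assms(2) by metis
  define \<nu>s where "\<nu>s n = (case prod_decode n of (i, j) \<Rightarrow> ls i j)" for n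
  have "is_kernel_sum X Y k \<nu>s"
    unfolding is_kernel_sum_def
  proof (intro ballI)
    fix x V assume "x \<in> space X" "V \<in> sets Y"
    then have "emeasure (k x) V = (\<Sum>i. \<Sum>j. emeasure (ls i j x) V)"
      using assms(1) ls(2) by (simp add: is_kernel_sum_def)
    also have "\<dots> = (\<Sum>n. emeasure (\<nu>s n x) V)"
      by (subst ennreal_suminf_prod_decode[symmetric])
        (auto simp: \<nu>s_def split: prod.split intro!: suminf_cong)
    finally show "emeasure (k x) V = (\<Sum>n. emeasure (\<nu>s n x) V)" .
  qed
  moreover have "subprob_kernel X Y (\<nu>s n)" for n
    by (auto simp: \<nu>s_def ls(1) split: prod.split)
  ultimately show ?thesis by blast
qed

lemma s_finite_kernelD:
  "s_finite_kernel X Y k \<Longrightarrow> \<exists>\<nu>s. (\<forall>n. subprob_kernel X Y (\<nu>s n)) \<and> is_kernel_sum X Y k \<nu>s"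
  unfolding s_finite_kernel_def using sum_subprob_of_sum finite_kernel_eq_sum_subprob by metis

lemma s_finite_kernelI:
  assumes "\<And>x. x \<in> space X \<Longrightarrow> sets (k x) = sets Y"
    and "\<And>n. subprob_kernel X Y (ks n)" "is_kernel_sum X Y k ks"
  shows "s_finite_kernel X Y k"
proof -
  have "is_kernel X Y k"
    using assms by (intro is_kernel_of_sum[of X k Y ks]) (auto simp: subprob_kernel_iff)
  with assms show ?thesis
    unfolding s_finite_kernel_def by (blast intro: subprob_kernel_finite)
qed

section \<open>Pushforwards of sigma-finite kernels\<close>

lemma emeasure_kernel_pushforward:
  assumes "is_kernel X W k" "h \<in> measurable W Y" "x \<in> space X" "V \<in> sets Y"
  shows "emeasure (kernel_pushforward Y h k x) V = emeasure (k x) (h -` V \<inter> space W)"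
proof -
  have [measurable_cong]: "sets (k x) = sets W"
    using assms by (simp add: is_kernel_sets)
  have "h \<in> measurable (k x) Y"
    using assms(2) by measurable
  then show ?thesis
    using assms by (simp add: kernel_pushforward_def emeasure_distr is_kernel_space)
qed

lemma is_kernel_pushforward:
  assumes "is_kernel X W k" "h \<in> measurable W Y"
  shows "is_kernel X Y (kernel_pushforward Y h k)"
  unfolding is_kernel_def
proof (intro conjI ballI)
  fix V assume V: "V \<in> sets Y"
  have "(\<lambda>x. emeasure (k x) (h -` V \<inter> space W)) \<in> borel_measurable X"
    using assms V by (intro is_kernel_measurable_emeasure) auto
  then show "(\<lambda>x. emeasure (kernel_pushforward Y h k x) V) \<in> borel_measurable X"
    by (rule measurable_cong[THEN iffD1, rotated])
      (simp add: emeasure_kernel_pushforward[OF assms _ V])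
qed (simp add: kernel_pushforward_def)

lemma finite_kernel_pushforward:
  assumes k: "finite_kernel X W k" and h: "h \<in> measurable W Y"
  shows "finite_kernel X Y (kernel_pushforward Y h k)"
proof -
  have "h -` space Y \<inter> space W = space W"
    using measurable_space[OF h] by auto
  then show ?thesis
    using k h
    by (simp add: finite_kernel_iff is_kernel_pushforward[of X W] emeasure_kernel_pushforward[of X W])
qed

text \<open>Pushing forward preserves sums and total masses, while \<open>h\<close> may superimpose
  disjoint pieces; so s-finiteness is what the image inherits.\<close>

lemma s_finite_pushforward_sigma_finite:
  assumes "is_kernel X Y \<nu>" "pushforward_of_sigma_finite W X Y \<nu>"
  shows "s_finite_kernel X Y \<nu>"
proof -
  obtain \<mu> h ks where h: "h \<in> measurable W Y" and \<nu>: "kernel_eq X \<nu> (kernel_pushforward Y h \<mu>)"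
    and \<mu>: "is_kernel X W \<mu>" and ks: "\<And>i. finite_kernel X W (ks i)"
    and sum: "is_kernel_sum X W \<mu> ks"
    using assms(2) unfolding pushforward_of_sigma_finite_def sigma_finite_kernel_def by blast
  have "is_kernel X W (ks i)" for i
    using ks finite_kernel_def by blast
  note em = emeasure_kernel_pushforward[OF this h] emeasure_kernel_pushforward[OF \<mu> h]
  have "is_kernel_sum X Y \<nu> (\<lambda>i. kernel_pushforward Y h (ks i))"
    using sum \<nu> measurable_sets[OF h] by (auto simp: is_kernel_sum_def kernel_eq_def em)
  then show ?thesis
    using assms(1) finite_kernel_pushforward[OF ks h] unfolding s_finite_kernel_def
    by (intro conjI exI[of _ "\<lambda>i. kernel_pushforward Y h (ks i)"]) auto
qed

lemma pushforward_sigma_finite_of_s_finite: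
  fixes Y :: "'b measure"
  assumes "s_finite_kernel X Y \<nu>"
  shows "\<exists>W :: (nat \<times> 'b) measure. pushforward_of_sigma_finite W X Y \<nu>"
proof -
  define W where "W = count_space (UNIV :: nat set) \<Otimes>\<^sub>M Y"
  obtain ks where \<nu>: "is_kernel X Y \<nu>" and ks: "\<And>i. finite_kernel X Y (ks i)"
    and sum: "is_kernel_sum X Y \<nu> ks"
    using assms by (auto simp: s_finite_kernel_def)
  have k: "is_kernel X Y (ks i)" for i
    using ks by (simp add: finite_kernel_def)
  have Pair_W: "Pair i \<in> measurable Y W" for i
    unfolding W_def by measurable
  have snd_W: "snd \<in> measurable W Y"
    unfolding W_def by measurable
  have space_W: "space W = UNIV \<times> space Y"
    by (simp add: W_def space_pair_measure)
  define \<mu>s where "\<mu>s i = kernel_pushforward W (Pair i) (ks i)" for i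
  define \<mu> where "\<mu> x = sum_measure W (\<lambda>i. \<mu>s i x)" for x
  have \<mu>s: "finite_kernel X W (\<mu>s i)" for i
    unfolding \<mu>s_def by (rule finite_kernel_pushforward[OF ks Pair_W])
  have sets_\<mu>s: "sets (\<mu>s i x) = sets W" for i x
    by (simp add: \<mu>s_def kernel_pushforward_def)
  have sum_\<mu>: "is_kernel_sum X W \<mu> \<mu>s"
    by (simp add: is_kernel_sum_def \<mu>_def emeasure_sum_measure sets_\<mu>s)
  have \<mu>: "is_kernel X W \<mu>"
    using \<mu>s sum_\<mu> by (intro is_kernel_of_sum[of X \<mu> W \<mu>s]) (auto simp: \<mu>_def finite_kernel_def)
  have "mutually_singular X W (\<mu>s i) (\<mu>s j)" if "i \<noteq> j" for i j
    unfolding mutually_singular_def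
  proof (intro bexI conjI)
    let ?A = "space X \<times> ({i} \<times> space Y)"
    have "{i} \<times> space Y \<in> sets W"
      unfolding W_def by (intro pair_measureI) auto
    then show "?A \<in> sets (X \<Otimes>\<^sub>M W)"
      by (intro pair_measureI) auto
    have i: "space W - {w. (x, w) \<in> ?A} = (- {i}) \<times> space Y" if "x \<in> space X" for x
      using that by (auto simp: space_W)
    have j: "space W - {w. (x, w) \<in> space X \<times> space W - ?A} = {i} \<times> space Y" if "x \<in> space X" for x
      using that by (auto simp: space_W)
    have meas: "S \<times> space Y \<in> sets W" for S
      unfolding W_def by (intro pair_measureI) auto
    \<comment> \<open>Copy n meets \<open>S \<times> space Y\<close> only if n is in S. This is
      applied to \<open>\<mu>s i\<close> with S the complement of {i}, and to
      \<open>\<mu>s j\<close> with S = {i}.\<close>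
    have "Pair n -` (S \<times> space Y) \<inter> space Y = (if n \<in> S then space Y else {})" for n S
      by auto
    then have em: "emeasure (\<mu>s n x) (S \<times> space Y) = 0" if "x \<in> space X" "n \<notin> S" for n S x
      using that unfolding \<mu>s_def
      by (subst emeasure_kernel_pushforward[OF k Pair_W _ meas]) auto
    show "supported_in X W (\<mu>s i) ?A"
      unfolding supported_in_def
    proof
      fix x assume x: "x \<in> space X"
      show "emeasure (\<mu>s i x) (space W - {w. (x, w) \<in> ?A}) = 0"
        unfolding i[OF x] by (rule em[OF x]) simp
    qed
    show "supported_in X W (\<mu>s j) (space X \<times> space W - ?A)"
      unfolding supported_in_def
    proof
      fix x assume x: "x \<in> space X"
      show "emeasure (\<mu>s j x) (space W - {w. (x, w) \<in> space X \<times> space W - ?A}) = 0"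
        unfolding j[OF x] using that by (intro em[OF x]) simp
    qed
  qed
  then have "sigma_finite_kernel X W \<mu>"
    using \<mu> \<mu>s sum_\<mu> unfolding sigma_finite_kernel_def by blast
  moreover have "\<nu> x = kernel_pushforward Y snd \<mu> x" if x: "x \<in> space X" for x
  proof (rule measure_eqI)
    show "sets (\<nu> x) = sets (kernel_pushforward Y snd \<mu> x)"
      using \<nu> x by (simp add: is_kernel_sets kernel_pushforward_def)
    fix V assume "V \<in> sets (\<nu> x)"
    then have V: "V \<in> sets Y"
      using \<nu> x by (simp add: is_kernel_sets)
    have V': "snd -` V \<inter> space W \<in> sets W"
      using snd_W V by auto
    have "Pair i -` (snd -` V \<inter> space W) \<inter> space Y = V" for i
      using sets.sets_into_space[OF V] by (auto simp: space_W)
    then have "emeasure (\<mu>s i x) (snd -` V \<inter> space W) = emeasure (ks i x) V" for i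
      unfolding \<mu>s_def by (subst emeasure_kernel_pushforward[OF k Pair_W x V']) simp
    then show "emeasure (\<nu> x) V = emeasure (kernel_pushforward Y snd \<mu> x) V"
      using sum sum_\<mu> x V V'
      by (simp add: emeasure_kernel_pushforward[OF \<mu> snd_W x V] is_kernel_sum_def)
  qed
  ultimately show ?thesis
    using snd_W unfolding pushforward_of_sigma_finite_def kernel_eq_def by blast
qed

section \<open>Densities\<close>

text \<open>\<open>k\<close> is read as a measurable map into \<open>subprob_algebra Y\<close>.
  Elements of that space have nonempty carrier, so an empty Y is split off; there all integrals are
  0.\<close>

lemma measurable_nn_integral_subprob_kernel:
  assumes k: "subprob_kernel X Y k" and f: "f \<in> borel_measurable (X \<Otimes>\<^sub>M Y)"
  shows "(\<lambda>x. \<integral>\<^sup>+y. f (x, y) \<partial>k x) \<in> borel_measurable X"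
proof (cases "space Y = {}")
  case True
  then have "(\<integral>\<^sup>+y. f (x, y) \<partial>k x) = 0" if "x \<in> space X" for x
    using that k by (intro nn_integral_empty) (simp add: subprob_kernel_iff is_kernel_space)
  then show ?thesis
    by (subst measurable_cong[of _ _ "\<lambda>_. 0"]) auto
next
  case False
  then have "k \<in> measurable X (subprob_algebra Y)"
    using k subprob_kernel_subprob_space[OF k]
    by (intro measurable_subprob_algebra) (auto simp: subprob_kernel_iff is_kernel_def)
  then show ?thesis
    using f by (intro nn_integral_measurable_subprob_algebra2[where N=Y]) auto
qed

lemma emeasure_kernel_density:
  assumes "is_kernel X Y k" "x \<in> space X" "(\<lambda>y. f (x, y)) \<in> borel_measurable Y" "V \<in> sets Y"
  shows "emeasure (kernel_density k f x) V = (\<integral>\<^sup>+y. f (x, y) * indicator V y \<partial>k x)"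
proof -
  have [measurable_cong]: "sets (k x) = sets Y"
    using assms by (simp add: is_kernel_sets)
  show ?thesis
    unfolding kernel_density_def using assms by (intro emeasure_density) auto
qed

lemma is_kernel_density:
  assumes k: "subprob_kernel X Y k" and f [measurable]: "f \<in> borel_measurable (X \<Otimes>\<^sub>M Y)"
  shows "is_kernel X Y (kernel_density k f)"
  unfolding is_kernel_def
proof (intro conjI ballI)
  have ker: "is_kernel X Y k"
    using k by (simp add: subprob_kernel_iff)
  then show "sets (kernel_density k f x) = sets Y" if "x \<in> space X" for x
    using that by (simp add: kernel_density_def is_kernel_sets)
  fix V assume V [measurable]: "V \<in> sets Y"
  have "(\<lambda>x. \<integral>\<^sup>+y. (\<lambda>(x, y). f (x, y) * indicator V y) (x, y) \<partial>k x) \<in> borel_measurable X"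
    by (intro measurable_nn_integral_subprob_kernel[OF k]) measurable
  then show "(\<lambda>x. emeasure (kernel_density k f x) V) \<in> borel_measurable X"
    by (rule measurable_cong[THEN iffD1, rotated]) (simp add: emeasure_kernel_density[OF ker])
qed

text \<open>Slicing the range of \<open>f\<close> into unit layers is uniform in \<open>f\<close> and also covers the value \<open>\<infinity>\<close>.\<close>

lemma ennreal_eq_suminf_layers:
  fixes a :: ennreal
  shows "a = (\<Sum>j. min 1 (a - of_nat j))"
proof -
  have layers: "(\<Sum>j<n. min 1 (a - of_nat j)) = min (of_nat n) a" for n
  proof (induction n)
    case (Suc n)
    have "min (of_nat n) a + min 1 (a - of_nat n) = min (of_nat (Suc n)) a"
    proof (cases "a \<le> of_nat n")
      case True
      then have "a - of_nat n = 0"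
        using of_nat_less_top[of n] by (simp add: diff_eq_0_iff_ennreal)
      moreover have "a \<le> of_nat (Suc n)"
        using True by (rule order_trans) simp
      ultimately show ?thesis
        using True by (simp add: min_absorb2)
    next
      case False
      then have "of_nat n + (a - of_nat n) = a"
        by (intro add_diff_inverse_ennreal) simp
      moreover have "min (of_nat n + 1) (of_nat n + (a - of_nat n)) = of_nat n + min 1 (a - of_nat n)"
        by (intro min_of_mono) (simp add: mono_def add_left_mono)
      ultimately have "of_nat n + min 1 (a - of_nat n) = min (of_nat n + 1) a"
        by (simp only:)
      with False show ?thesis
        by (simp add: min_absorb1 add.commute)
    qed
    with Suc show ?case by simp
  qed simp
  have "(SUP n. min (of_nat n) a) = a"
  proof (rule antisym)
    show "a \<le> (SUP n. min (of_nat n) a)"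
    proof (cases "a = top")
      case True
      then show ?thesis by (simp add: min_absorb1 ennreal_SUP_of_nat_eq_top)
    next
      case False
      then obtain n :: nat where "a < of_nat n"
        using ennreal_Ex_less_of_nat[of a] by (auto simp: less_top)
      then show ?thesis by (intro SUP_upper2[of n]) auto
    qed
  qed (auto intro: SUP_least)
  then show ?thesis
    by (subst suminf_eq_SUP) (simp add: layers)
qed

text \<open>Both arguments are decomposed: \<open>\<nu>\<close> into subprobability kernels
  \<open>\<nu>s n\<close>, and f into layers \<open>g j\<close> bounded by 1. Each
  \<open>kernel_density (\<nu>s n) (g j)\<close> lies below \<open>\<nu>s n\<close>, hence is a
  subprobability kernel, and the whole grid sums to the density kernel.\<close>

lemma s_finite_kernel_density:
  assumes \<nu>: "s_finite_kernel X Y \<nu>" and f [measurable]: "f \<in> borel_measurable (X \<Otimes>\<^sub>M Y)"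
  shows "s_finite_kernel X Y (kernel_density \<nu> f)"
proof -
  obtain \<nu>s where \<nu>s: "\<And>n. subprob_kernel X Y (\<nu>s n)" and sum: "is_kernel_sum X Y \<nu> \<nu>s"
    using s_finite_kernelD[OF \<nu>] by blast
  have ker: "is_kernel X Y \<nu>" "is_kernel X Y (\<nu>s n)" for n
    using \<nu> \<nu>s by (simp_all add: s_finite_kernel_def subprob_kernel_iff)
  define g where "g j = (\<lambda>p. min 1 (f p - of_nat j))" for j
  have g [measurable]: "g j \<in> borel_measurable (X \<Otimes>\<^sub>M Y)" for j
    unfolding g_def by measurable
  have sec: "(\<lambda>y. f' (x, y)) \<in> borel_measurable Y"
    if "f' \<in> borel_measurable (X \<Otimes>\<^sub>M Y)" "x \<in> space X" for f' :: "_ \<Rightarrow> ennreal" and x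
    using that by measurable
  have sub: "subprob_kernel X Y (kernel_density (\<nu>s n) (g j))" for n j
    unfolding subprob_kernel_iff
  proof (intro conjI ballI is_kernel_density \<nu>s g)
    fix x assume x: "x \<in> space X"
    have "emeasure (kernel_density (\<nu>s n) (g j) x) (space Y) \<le> (\<integral>\<^sup>+y. indicator (space Y) y \<partial>\<nu>s n x)"
      by (subst emeasure_kernel_density[OF ker(2) x sec[OF g x]])
        (auto intro!: nn_integral_mono simp: g_def indicator_def)
    also have "\<dots> \<le> 1"
      using \<nu>s x is_kernel_sets[OF ker(2) x] by (simp add: subprob_kernel_iff)
    finally show "emeasure (kernel_density (\<nu>s n) (g j) x) (space Y) \<le> 1" .
  qed
  \<comment> \<open>For fixed n the sum over layers is monotone convergence in the integrand; the
    sum over n below is additivity in the measure.\<close>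
  have sum_g: "is_kernel_sum X Y (kernel_density (\<nu>s n) f) (\<lambda>j. kernel_density (\<nu>s n) (g j))" for n
    unfolding is_kernel_sum_def
  proof (intro ballI)
    fix x V assume x: "x \<in> space X" and V [measurable]: "V \<in> sets Y"
    have [measurable_cong]: "sets (\<nu>s n x) = sets Y"
      using ker x by (simp add: is_kernel_sets[of X Y])
    have [measurable]: "(\<lambda>y. g j (x, y)) \<in> borel_measurable (\<nu>s n x)" for j
      using sec[OF g x] by measurable
    have "(\<integral>\<^sup>+y. f (x, y) * indicator V y \<partial>\<nu>s n x)
        = (\<integral>\<^sup>+y. (\<Sum>j. g j (x, y) * indicator V y) \<partial>\<nu>s n x)"
      unfolding ennreal_suminf_multc g_def ennreal_eq_suminf_layers[symmetric] ..
    also have "\<dots> = (\<Sum>j. \<integral>\<^sup>+y. g j (x, y) * indicator V y \<partial>\<nu>s n x)"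
      by (intro nn_integral_suminf) measurable
    finally show "emeasure (kernel_density (\<nu>s n) f x) V
        = (\<Sum>j. emeasure (kernel_density (\<nu>s n) (g j) x) V)"
      using x V sec by (simp add: emeasure_kernel_density[OF ker(2)])
  qed
  have sum_\<nu>s: "is_kernel_sum X Y (kernel_density \<nu> f) (\<lambda>n. kernel_density (\<nu>s n) f)"
    unfolding is_kernel_sum_def
  proof (intro ballI)
    fix x V assume x: "x \<in> space X" and V [measurable]: "V \<in> sets Y"
    have sets: "sets (\<nu> x) = sets Y" "sets (\<nu>s n x) = sets Y" for n
      using ker x by (simp_all add: is_kernel_sets[of X Y])
    note [measurable_cong] = sets(1)
    have [measurable]: "(\<lambda>y. f (x, y)) \<in> borel_measurable (\<nu> x)"
      using sec[OF f x] by measurable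
    have "(\<integral>\<^sup>+y. f (x, y) * indicator V y \<partial>\<nu> x) = (\<Sum>n. \<integral>\<^sup>+y. f (x, y) * indicator V y \<partial>\<nu>s n x)"
      using sum x by (intro nn_integral_measure_sum) (auto simp: sets is_kernel_sum_def)
    then show "emeasure (kernel_density \<nu> f x) V = (\<Sum>n. emeasure (kernel_density (\<nu>s n) f x) V)"
      using x V sec by (simp add: emeasure_kernel_density[OF ker(1)] emeasure_kernel_density[OF ker(2)])
  qed
  have "\<exists>ls. (\<forall>j. subprob_kernel X Y (ls j)) \<and> is_kernel_sum X Y (kernel_density (\<nu>s n) f) ls" for n
    by (intro exI[of _ "\<lambda>j. kernel_density (\<nu>s n) (g j)"]) (simp add: sub sum_g)
  then obtain ks where "\<And>n. subprob_kernel X Y (ks n)" "is_kernel_sum X Y (kernel_density \<nu> f) ks"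
    using sum_subprob_of_sum[OF sum_\<nu>s] by blast
  moreover have "sets (kernel_density \<nu> f x) = sets Y" if "x \<in> space X" for x
    using that ker(1) by (simp add: kernel_density_def is_kernel_sets)
  ultimately show ?thesis
    by (intro s_finite_kernelI)
qed

section \<open>Approximation over a countable generator\<close>

text \<open>Lists with possibly overlapping sets, instead of disjoint normal forms: countability is
  that of finite lists over a countable set, and addition is concatenation.\<close>

definition rational_steps :: "'b set set \<Rightarrow> ('b \<Rightarrow> real) set" where
  "rational_steps E = (\<lambda>l y. \<Sum>(q, A)\<leftarrow>l. q * indicator A y) ` lists (\<rat> \<times> E)"

lemma countable_rational_steps: "countable E \<Longrightarrow> countable (rational_steps E)"
  unfolding rational_steps_def by (intro countable_image countable_lists countable_SIGMA countable_rat)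

lemma zero_in_rational_steps: "(\<lambda>_. 0) \<in> rational_steps E"
  unfolding rational_steps_def by (rule image_eqI[of _ _ "[]"]) auto

lemma indicator_in_rational_steps:
  "q \<in> \<rat> \<Longrightarrow> A \<in> E \<Longrightarrow> (\<lambda>y. q * indicator A y) \<in> rational_steps E"
  unfolding rational_steps_def by (rule image_eqI[of _ _ "[(q, A)]"]) auto

lemma add_in_rational_steps:
  assumes "g \<in> rational_steps E" "g' \<in> rational_steps E"
  shows "(\<lambda>y. g y + g' y) \<in> rational_steps E"
proof -
  obtain l l' where "l \<in> lists (\<rat> \<times> E)" "g = (\<lambda>y. \<Sum>(q, A)\<leftarrow>l. q * indicator A y)"
    "l' \<in> lists (\<rat> \<times> E)" "g' = (\<lambda>y. \<Sum>(q, A)\<leftarrow>l'. q * indicator A y)"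
    using assms by (auto simp: rational_steps_def)
  then show ?thesis
    unfolding rational_steps_def by (intro image_eqI[of _ _ "l @ l'"]) auto
qed

lemma borel_measurable_rational_steps:
  assumes "E \<subseteq> sets M" "g \<in> rational_steps E"
  shows "g \<in> borel_measurable M"
proof -
  obtain l where l: "l \<in> lists (\<rat> \<times> E)" and g: "g = (\<lambda>y. \<Sum>(q, A)\<leftarrow>l. q * indicator A y)"
    using assms by (auto simp: rational_steps_def)
  have "(\<lambda>y. \<Sum>(q, A)\<leftarrow>l. q * indicator A y) \<in> borel_measurable M"
    using l
  proof induction
    case (Cons a l)
    then have "snd a \<in> sets M"
      using assms(1) by auto
    with Cons show ?case
      by (auto simp: case_prod_beta intro!: borel_measurable_add borel_measurable_times)
  qed simp
  then show ?thesis by (simp add: g)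
qed

lemma (in finite_measure) integrable_rational_steps:
  assumes "E \<subseteq> sets M" "g \<in> rational_steps E"
  shows "integrable M g"
proof -
  obtain l where l: "l \<in> lists (\<rat> \<times> E)" and g: "g = (\<lambda>y. \<Sum>(q, A)\<leftarrow>l. q * indicator A y)"
    using assms by (auto simp: rational_steps_def)
  have "integrable M (\<lambda>y. \<Sum>(q, A)\<leftarrow>l. q * indicator A y)"
    using l
  proof induction
    case (Cons a l)
    then have "snd a \<in> sets M"
      using assms(1) by auto
    with Cons show ?case
      by (auto simp: case_prod_beta less_top[symmetric]
          intro!: Bochner_Integration.integrable_add integrable_mult_right)
  qed simp
  then show ?thesis by (simp add: g)
qed

text \<open>The L^1-closure of the rational steps, here \<open>P\<close>, is stable under addition
  and dominated limits. It contains the multiples of indicators of E, by a Dynkin argument those of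
  all measurable sets, and hence all integrable functions.\<close>

lemma (in finite_measure) integrable_approx_rational_steps:
  assumes E: "sets M = sigma_sets (space M) E" "Int_stable E" "E \<subseteq> Pow (space M)" "space M \<in> E"
    and f: "integrable M f" and e: "e > 0"
  shows "\<exists>g\<in>rational_steps E. (\<integral>y. \<bar>f y - g y\<bar> \<partial>M) < e"
proof -
  have E_sets: "E \<subseteq> sets M"
    unfolding E(1) by auto
  note int_step = integrable_rational_steps[OF E_sets]
  define P where "P f \<longleftrightarrow> (\<forall>e>0. \<exists>g\<in>rational_steps E. (\<integral>y. \<bar>f y - g y\<bar> \<partial>M) < e)"
    for f :: "'a \<Rightarrow> real"
  have P_add: "P (\<lambda>y. f y + f' y)"
    if f: "integrable M f" "P f" and f': "integrable M f'" "P f'" for f f'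
    unfolding P_def
  proof (intro allI impI)
    fix e :: real assume "e > 0"
    then obtain g g' where g: "g \<in> rational_steps E" "(\<integral>y. \<bar>f y - g y\<bar> \<partial>M) < e / 2"
      and g': "g' \<in> rational_steps E" "(\<integral>y. \<bar>f' y - g' y\<bar> \<partial>M) < e / 2"
      using f(2) f'(2) unfolding P_def by (meson half_gt_zero)
    note int = f(1) f'(1) int_step[OF g(1)] int_step[OF g'(1)]
    have "(\<integral>y. \<bar>f y + f' y - (g y + g' y)\<bar> \<partial>M) \<le> (\<integral>y. \<bar>f y - g y\<bar> + \<bar>f' y - g' y\<bar> \<partial>M)"
      using int by (intro integral_mono) auto
    also have "\<dots> = (\<integral>y. \<bar>f y - g y\<bar> \<partial>M) + (\<integral>y. \<bar>f' y - g' y\<bar> \<partial>M)"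
      using int by (intro Bochner_Integration.integral_add) auto
    also have "\<dots> < e"
      using g g' by simp
    finally show "\<exists>g\<in>rational_steps E. (\<integral>y. \<bar>f y + f' y - g y\<bar> \<partial>M) < e"
      using add_in_rational_steps[OF g(1) g'(1)] by (intro bexI[of _ "\<lambda>y. g y + g' y"])
  qed
  have P_lim: "P f"
    if f: "integrable M f" and s: "\<And>i. integrable M (s i)" "\<And>i. P (s i)"
      and lim: "\<And>y. y \<in> space M \<Longrightarrow> (\<lambda>i. s i y) \<longlonglongrightarrow> f y"
      and w: "integrable M w" "\<And>i y. y \<in> space M \<Longrightarrow> \<bar>s i y\<bar> \<le> w y" for f w s
    unfolding P_def
  proof (intro allI impI)
    fix e :: real assume e: "e > 0"
    have "(\<lambda>i. \<integral>y. \<bar>f y - s i y\<bar> \<partial>M) \<longlonglongrightarrow> (\<integral>y. 0 \<partial>M)"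
    proof (rule integral_dominated_convergence)
      show "AE y in M. (\<lambda>i. \<bar>f y - s i y\<bar>) \<longlonglongrightarrow> 0"
      proof (rule AE_I2)
        fix y assume "y \<in> space M"
        then have "(\<lambda>i. \<bar>f y - s i y\<bar>) \<longlonglongrightarrow> \<bar>f y - f y\<bar>"
          using lim by (intro tendsto_intros)
        then show "(\<lambda>i. \<bar>f y - s i y\<bar>) \<longlonglongrightarrow> 0" by simp
      qed
      show "integrable M (\<lambda>y. \<bar>f y\<bar> + w y)"
        using f w by auto
      show "AE y in M. norm \<bar>f y - s i y\<bar> \<le> \<bar>f y\<bar> + w y" for i
      proof (rule AE_I2)
        fix y assume "y \<in> space M"
        then show "norm \<bar>f y - s i y\<bar> \<le> \<bar>f y\<bar> + w y"
          using w(2)[of y i] by auto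
      qed
    qed (use f s(1) in auto)
    then have "eventually (\<lambda>i. (\<integral>y. \<bar>f y - s i y\<bar> \<partial>M) < e / 2) sequentially"
      using e by (intro order_tendstoD) auto
    then obtain i where i: "(\<integral>y. \<bar>f y - s i y\<bar> \<partial>M) < e / 2"
      by (meson eventually_happens sequentially_bot)
    obtain g where g: "g \<in> rational_steps E" "(\<integral>y. \<bar>s i y - g y\<bar> \<partial>M) < e / 2"
      using s(2) e unfolding P_def by (meson half_gt_zero)
    note int = f s(1)[of i] int_step[OF g(1)]
    have "(\<integral>y. \<bar>f y - g y\<bar> \<partial>M) \<le> (\<integral>y. \<bar>f y - s i y\<bar> + \<bar>s i y - g y\<bar> \<partial>M)"
      using int by (intro integral_mono) auto
    also have "\<dots> = (\<integral>y. \<bar>f y - s i y\<bar> \<partial>M) + (\<integral>y. \<bar>s i y - g y\<bar> \<partial>M)"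
      using int by (intro Bochner_Integration.integral_add) auto
    also have "\<dots> < e"
      using g i by simp
    finally show "\<exists>g\<in>rational_steps E. (\<integral>y. \<bar>f y - g y\<bar> \<partial>M) < e"
      using g(1) by blast
  qed
  have P_0: "P (\<lambda>_. 0)"
    unfolding P_def using zero_in_rational_steps by (force intro: bexI[of _ "\<lambda>_. 0"])
  have int_ind: "integrable M (\<lambda>y. c * indicator A y)" if "A \<in> sets M" for A and c :: real
    using that by (intro integrable_mult_right) (auto simp: less_top[symmetric])
  have P_E: "P (\<lambda>y. c * indicator A y)" if A: "A \<in> E" for A c
    unfolding P_def
  proof (intro allI impI)
    fix e :: real assume e: "e > 0"
    \<comment> \<open>The slack for the rational coefficient is e divided by the mass of A; adding 1
      covers null sets A.\<close>
    have "e / (measure M A + 1) > 0"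
      using e by (simp add: add_nonneg_pos)
    then obtain q where q: "q \<in> \<rat>" "c < q" "q < c + e / (measure M A + 1)"
      using Rats_dense_in_real[of c "c + e / (measure M A + 1)"] by auto
    have "(\<integral>y. \<bar>c * indicator A y - q * indicator A y\<bar> \<partial>M) = (\<integral>y. (q - c) * indicator A y \<partial>M)"
      using q by (intro Bochner_Integration.integral_cong) (auto simp: indicator_def)
    also have "\<dots> = (q - c) * measure M A"
      using A E_sets by (subst integral_mult_right_zero) (auto simp: Int_absorb2 sets.sets_into_space)
    also have "\<dots> \<le> (q - c) * (measure M A + 1)"
      using q by (intro mult_left_mono) auto
    also have "\<dots> < e"
      using q by (simp add: add_nonneg_pos flip: pos_less_divide_eq)
    finally show "\<exists>g\<in>rational_steps E. (\<integral>y. \<bar>c * indicator A y - g y\<bar> \<partial>M) < e"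
      using indicator_in_rational_steps[OF q(1) A] by (intro bexI[of _ "\<lambda>y. q * indicator A y"])
  qed
  \<comment> \<open>The coefficient stays arbitrary in the induction because a complement
    contributes \<open>- c\<close> times the indicator of A, added to c times that of
    \<open>space M\<close>, which belongs to E.\<close>
  have P_ind: "P (\<lambda>y. c * indicator A y)" if "A \<in> sets M" for A c
    using E(2,3) that[unfolded E(1)]
  proof (induction arbitrary: c rule: sigma_sets_induct_disjoint)
    case (basic A)
    then show ?case by (rule P_E)
  next
    case empty
    then show ?case using P_0 by simp
  next
    case (compl A)
    then have A: "A \<in> sets M" by (simp add: E(1))
    have "P (\<lambda>y. c * indicator (space M) y + (- c) * indicator A y)"
      by (rule P_add[OF int_ind P_E int_ind compl.IH]) (use A E in auto)
    moreover have "(\<lambda>y. c * indicator (space M) y + (- c) * indicator A y)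
        = (\<lambda>y. c * indicator (space M - A) y)"
      using sets.sets_into_space[OF A] by (auto simp: indicator_def fun_eq_iff)
    ultimately show ?case by simp
  next
    case (union A)
    then have A: "range A \<subseteq> sets M" by (simp add: E(1))
    define s where "s n y = (\<Sum>i<n. c * indicator (A i) y)" for n y
    have s_int: "integrable M (s n)" for n
      unfolding s_def using A by (intro Bochner_Integration.integrable_sum int_ind) auto
    have s_P: "P (s n)" for n
    proof (induction n)
      case 0
      then show ?case using P_0 by (simp add: s_def)
    next
      case (Suc n)
      have "P (\<lambda>y. s n y + c * indicator (A n) y)"
        using A by (intro P_add s_int Suc union.IH int_ind) auto
      then show ?case by (simp add: s_def)
    qed
    have s_eq: "s n y = c * indicator (\<Union>i<n. A i) y" for n y
    proof -
      have "disjoint_family_on A {..<n}"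
        using union.hyps(1) by (auto simp: disjoint_family_on_def)
      then show ?thesis
        unfolding s_def by (simp add: indicator_UN_disjoint sum_distrib_left)
    qed
    show ?case
    proof (rule P_lim[OF int_ind s_int s_P])
      fix y
      have "(\<lambda>n. indicator (\<Union>i<n. A i) y :: real) \<longlonglongrightarrow> indicator (\<Union>i. A i) y"
        by (rule LIMSEQ_indicator_UN)
      then show "(\<lambda>n. s n y) \<longlonglongrightarrow> c * indicator (\<Union>i. A i) y"
        unfolding s_eq by (intro tendsto_intros)
      show "\<bar>s n y\<bar> \<le> \<bar>c\<bar>" for n
        unfolding s_eq by (auto simp: indicator_def)
    qed (use A in auto)
  qed
  have "P f"
    using f
  proof (induction rule: integrable_induct)
    case (base A c)
    then show ?case using P_ind[of A c] by (simp add: mult.commute)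
  next
    case (add f g)
    then show ?case by (intro P_add)
  next
    case (lim f s)
    \<comment> \<open>The approximants supplied by \<open>integrable_induct\<close> are bounded by
      twice the norm of f, which gives the majorant.\<close>
    show ?case
      by (rule P_lim[of f s "\<lambda>y. 2 * norm (f y)"]) (use lim in auto)
  qed
  with e show ?thesis by (simp add: P_def)
qed

text \<open>Clamping to [0,1] fixes h and does not increase distances, so the error d satisfies |d|
  \<le> 1 and hence d^2 \<le> |d|. Density in L^1 thus passes to L^2.\<close>

lemma (in finite_measure) square_approx_rational_steps:
  assumes E: "sets M = sigma_sets (space M) E" "Int_stable E" "E \<subseteq> Pow (space M)" "space M \<in> E"
    and h [measurable]: "h \<in> borel_measurable M" and h01: "\<And>y. 0 \<le> h y \<and> h y \<le> (1::real)"
    and e: "e > 0"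
  shows "\<exists>g\<in>rational_steps E. (\<integral>y. (h y - max 0 (min 1 (g y)))\<^sup>2 \<partial>M) < e"
proof -
  have E_sets: "E \<subseteq> sets M"
    unfolding E(1) by auto
  have int_h: "integrable M h"
    by (rule integrable_const_bound[of _ 1]) (use h01 in auto)
  obtain g where g: "g \<in> rational_steps E" and ge: "(\<integral>y. \<bar>h y - g y\<bar> \<partial>M) < e"
    using integrable_approx_rational_steps[OF E int_h e] by blast
  note [measurable] = borel_measurable_rational_steps[OF E_sets g]
  have le: "(h y - max 0 (min 1 (g y)))\<^sup>2 \<le> \<bar>h y - g y\<bar>" "(h y - max 0 (min 1 (g y)))\<^sup>2 \<le> 1" for y
  proof -
    let ?d = "\<bar>h y - max 0 (min 1 (g y))\<bar>"
    have d: "?d \<le> 1" "?d \<le> \<bar>h y - g y\<bar>"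
      using h01[of y] by auto
    have "?d * ?d \<le> 1 * ?d"
      using d by (intro mult_right_mono) auto
    then have "(h y - max 0 (min 1 (g y)))\<^sup>2 \<le> ?d"
      by (simp add: power2_eq_square flip: abs_mult)
    with d show "(h y - max 0 (min 1 (g y)))\<^sup>2 \<le> \<bar>h y - g y\<bar>" "(h y - max 0 (min 1 (g y)))\<^sup>2 \<le> 1"
      by linarith+
  qed
  have "(\<integral>y. (h y - max 0 (min 1 (g y)))\<^sup>2 \<partial>M) \<le> (\<integral>y. \<bar>h y - g y\<bar> \<partial>M)"
  proof (rule integral_mono)
    show "integrable M (\<lambda>y. (h y - max 0 (min 1 (g y)))\<^sup>2)"
      by (rule integrable_const_bound[of _ 1]) (use le in auto)
  qed (use le int_h integrable_rational_steps[OF E_sets g] in auto)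
  with g ge show ?thesis by force
qed

text \<open>Balls with rational radii around a countable dense set form a countable basis, so every
  open set is a countable union of them; finite intersections then give stability.\<close>

lemma standard_borel_countable_generator:
  assumes "standard_borel Y"
  obtains E where "countable E" "Int_stable E" "E \<subseteq> Pow (space Y)" "space Y \<in> E"
    "sets Y = sigma_sets (space Y) E"
proof -
  obtain m where m: "mspace m = space Y" "separable_space (mtopology_of m)"
    and Y: "sets Y = sigma_sets (space Y) {U. openin (mtopology_of m) U}"
    using assms by (auto simp: standard_borel_def)
  interpret Metric_space "mspace m" "mdist m" by simp
  have top: "mtopology_of m = mtopology"
    by (simp add: mtopology_of_def)
  obtain C where C: "countable C" "C \<subseteq> mspace m" "mtopology closure_of C = mspace m"
    using m(2) by (auto simp: separable_space_def top)
  define B where "B = (\<lambda>(c, q). mball c q) ` (C \<times> \<rat>)"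
  have B_countable: "countable B"
    unfolding B_def by (intro countable_image countable_SIGMA C countable_rat)
  have B_open: "openin mtopology V" if "V \<in> B" for V
    using that by (auto simp: B_def)
  have B_basis: "U = \<Union>{V \<in> B. V \<subseteq> U}" if U: "openin mtopology U" for U
  proof
    show "U \<subseteq> \<Union>{V \<in> B. V \<subseteq> U}"
    proof
      fix x assume x: "x \<in> U"
      then obtain r where r: "r > 0" "mball x r \<subseteq> U" and xm: "x \<in> mspace m"
        using U unfolding openin_mtopology by blast
      have "x \<in> mtopology closure_of C"
        using C xm by simp
      then obtain c where c: "c \<in> C" "c \<in> mball x (r / 2)"
        using r(1) unfolding metric_closure_of by (auto dest!: spec[of _ "r / 2"])
      then have "mdist m x c < r / 2" by simp
      \<comment> \<open>A radius above the distance from x to c captures x; one below r/2 keeps the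
        ball around c inside the ball of radius r around x.\<close>
      then obtain q where q: "q \<in> \<rat>" "mdist m x c < q" "q < r / 2"
        using Rats_dense_in_real by blast
      have "mball c q \<subseteq> mball x r"
      proof
        fix z assume z: "z \<in> mball c q"
        then have "mdist m x z \<le> mdist m x c + mdist m c z"
          using xm by (intro triangle) auto
        with z q xm show "z \<in> mball x r" by auto
      qed
      moreover have "x \<in> mball c q"
        using q c xm by (auto simp: commute)
      moreover have "mball c q \<in> B"
        using c q by (auto simp: B_def)
      ultimately show "x \<in> \<Union>{V \<in> B. V \<subseteq> U}"
        using r by blast
    qed
  qed blast
  \<comment> \<open>Intersecting with \<open>space Y\<close> gives the empty family F the value
    \<open>space Y\<close> instead of \<open>UNIV\<close>, so that the whole space belongs to
    E.\<close>
  define E where "E = (\<lambda>F. space Y \<inter> \<Inter>F) ` {F. finite F \<and> F \<subseteq> B}"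
  have B_sub: "V \<subseteq> space Y" if "V \<in> B" for V
    using openin_subset[OF B_open[OF that]] unfolding topspace_mtopology m(1)[symmetric] .
  have B_E: "B \<subseteq> E"
  proof
    fix V assume "V \<in> B"
    then show "V \<in> E"
      unfolding E_def using B_sub[of V] by (intro image_eqI[of _ _ "{V}"]) auto
  qed
  have B_sets: "V \<in> sets Y" if "V \<in> B" for V
    unfolding Y top using B_open[OF that] by auto
  have E_sets: "E \<subseteq> sets Y"
  proof
    fix A assume "A \<in> E"
    then obtain F where F: "A = space Y \<inter> \<Inter>F" "finite F" "F \<subseteq> B"
      by (auto simp: E_def)
    show "A \<in> sets Y"
    proof (cases "F = {}")
      case False
      then have "\<Inter>F \<in> sets Y"
        using F B_sets sets.finite_INT[of F "\<lambda>V. V" Y] by auto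
      then show ?thesis by (simp add: F(1) sets.Int)
    qed (simp add: F(1))
  qed
  show thesis
  proof
    show "countable E"
      unfolding E_def using B_countable by (intro countable_image countable_Collect_finite_subset)
    show "Int_stable E"
    proof (rule Int_stableI)
      fix a b assume "a \<in> E" "b \<in> E"
      then obtain F F' where "a = space Y \<inter> \<Inter>F" "finite F" "F \<subseteq> B"
        "b = space Y \<inter> \<Inter>F'" "finite F'" "F' \<subseteq> B"
        by (auto simp: E_def)
      then show "a \<inter> b \<in> E"
        unfolding E_def by (intro image_eqI[of _ _ "F \<union> F'"]) auto
    qed
    show "E \<subseteq> Pow (space Y)" by (auto simp: E_def)
    show "space Y \<in> E"
      unfolding E_def by (intro image_eqI[of _ _ "{}"]) auto
    show "sets Y = sigma_sets (space Y) E"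
    proof
      interpret E: sigma_algebra "space Y" "sigma_sets (space Y) E"
        by (intro sigma_algebra_sigma_sets) (auto simp: E_def)
      have "U \<in> sigma_sets (space Y) E" if "openin mtopology U" for U
      proof -
        have "countable {V \<in> B. V \<subseteq> U}" "{V \<in> B. V \<subseteq> U} \<subseteq> sigma_sets (space Y) E"
          using B_countable B_E by auto
        then have "\<Union>{V \<in> B. V \<subseteq> U} \<in> sigma_sets (space Y) E"
          by (rule E.countable_Union)
        then show ?thesis using B_basis[OF that] by simp
      qed
      then show "sets Y \<subseteq> sigma_sets (space Y) E"
        unfolding Y top by (intro E.sigma_sets_subset) auto
      show "sigma_sets (space Y) E \<subseteq> sets Y"
        using E_sets by (rule sets.sigma_sets_subset)
    qed
  qed
qed

section \<open>Jointly measurable Radon--Nikodym derivatives\<close>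

text \<open>If the derivative exceeded 1 on a non-null set S, integrating it over S would give N
  more mass on S than M. Truncation at 1 therefore changes it on a null set only, and makes it
  real-valued and square integrable.\<close>

lemma (in finite_measure) dominated_density_le_1:
  assumes sets: "sets N = sets M"
    and le: "\<And>V. V \<in> sets M \<Longrightarrow> emeasure N V \<le> emeasure M V"
  obtains h :: "'a \<Rightarrow> real" where "h \<in> borel_measurable M" "\<And>y. 0 \<le> h y \<and> h y \<le> 1"
    "density M (\<lambda>y. ennreal (h y)) = N"
proof -
  have "absolutely_continuous M N"
    unfolding absolutely_continuous_def using le sets by (auto simp: null_sets_def) (metis le_zero_eq)
  then obtain h where h [measurable]: "h \<in> borel_measurable M" and N: "density M h = N"
    using Radon_Nikodym_finite_measure_infinite sets by blast
  define S where "S = {y \<in> space M. 1 < h y}"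
  have S [measurable]: "S \<in> sets M"
    unfolding S_def by measurable
  have "emeasure M S + (\<integral>\<^sup>+y. (h y - 1) * indicator S y \<partial>M)
      = (\<integral>\<^sup>+y. indicator S y + (h y - 1) * indicator S y \<partial>M)"
    by (subst nn_integral_add) auto
  also have "\<dots> = (\<integral>\<^sup>+y. h y * indicator S y \<partial>M)"
    by (intro nn_integral_cong) (auto simp: S_def indicator_def intro!: add_diff_inverse_ennreal less_imp_le)
  also have "\<dots> = emeasure N S"
    by (simp add: N[symmetric] emeasure_density)
  also have "\<dots> \<le> emeasure M S + 0"
    using le by simp
  finally have "(\<integral>\<^sup>+y. (h y - 1) * indicator S y \<partial>M) = 0"
    \<comment> \<open>Cancelling \<open>emeasure M S\<close> relies on M being finite.\<close>
    by (simp add: ennreal_add_left_cancel_le)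
  then have "AE y in M. (h y - 1) * indicator S y = 0"
    by (subst (asm) nn_integral_0_iff_AE) auto
  with AE_space have ae: "AE y in M. h y = ennreal (enn2real (min 1 (h y)))"
  proof eventually_elim
    case (elim y)
    show ?case
    proof (cases "y \<in> space M \<and> 1 < h y")
      case True
      then have "h y - 1 = 0"
        using elim by (simp add: S_def)
      with True show ?thesis
        by (simp add: diff_eq_0_iff_ennreal)
    next
      case False
      with elim(1) have "h y \<le> 1"
        by auto
      then show ?thesis
        by (simp add: min_absorb2 order_le_less_trans[OF _ ennreal_one_less_top])
    qed
  qed
  show thesis
  proof
    show "(\<lambda>y. enn2real (min 1 (h y))) \<in> borel_measurable M" by measurable
    show "0 \<le> enn2real (min 1 (h y)) \<and> enn2real (min 1 (h y)) \<le> 1" for y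
      using enn2real_mono[of "min 1 (h y)" 1] by auto
    show "density M (\<lambda>y. ennreal (enn2real (min 1 (h y)))) = N"
      unfolding N[symmetric] by (rule density_cong) (use ae in auto)
  qed
qed

text \<open>
  With \<open>h\<close> the derivative of \<open>l x\<close> with respect to \<open>k x\<close>, the squared \<open>L\<^sup>2(k x)\<close>-distance from \<open>g\<close>
  to \<open>h\<close> is \<open>\<integral>g\<^sup>2 d(k x) - 2 \<integral>g d(l x)\<close> plus a term not depending on \<open>g\<close>. The former is measurable
  in \<open>x\<close>, so a near-minimizer \<open>g\<close> within a countable dense family can be selected measurably in \<open>x\<close>.
\<close>

lemma jointly_measurable_density:
  assumes k: "subprob_kernel X Y k" and l: "subprob_kernel X Y l"
    and le: "\<And>x V. x \<in> space X \<Longrightarrow> V \<in> sets Y \<Longrightarrow> emeasure (l x) V \<le> emeasure (k x) V"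
    and E: "countable E" "Int_stable E" "E \<subseteq> Pow (space Y)" "space Y \<in> E"
      "sets Y = sigma_sets (space Y) E"
  obtains f where "f \<in> borel_measurable (X \<Otimes>\<^sub>M Y)"
    "\<And>x. x \<in> space X \<Longrightarrow> density (k x) (\<lambda>y. f (x, y)) = l x"
proof -
  have ker: "is_kernel X Y k" "is_kernel X Y l"
    using k l by (simp_all add: subprob_kernel_iff)
  have E_sets: "E \<subseteq> sets Y"
    unfolding E(5) by auto
  \<comment> \<open>Clamping matches the range of the derivative and makes every integral below
    finite.\<close>
  define G where "G = (\<lambda>g y. max 0 (min 1 (g y))) ` rational_steps E"
  have G: "countable G" "G \<noteq> {}"
    using countable_rational_steps[OF E(1)] zero_in_rational_steps[of E] by (auto simp: G_def)
  define g where "g = from_nat_into G"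
  have g_G: "g j \<in> G" for j
    unfolding g_def by (rule from_nat_into[OF G(2)])
  have g_meas [measurable]: "g j \<in> borel_measurable Y" for j
    using borel_measurable_rational_steps[OF E_sets] g_G[of j]
    by (auto simp: G_def intro!: borel_measurable_max borel_measurable_min)
  have g01: "0 \<le> g j y \<and> g j y \<le> 1" for j y
    using g_G[of j] by (auto simp: G_def)
  have int_meas: "(\<lambda>x. \<integral>y. u y \<partial>K x) \<in> borel_measurable X"
    if K: "subprob_kernel X Y K" and u [measurable]: "u \<in> borel_measurable Y"
      and u0: "\<And>y. 0 \<le> u y" for K and u :: "'b \<Rightarrow> real"
  proof -
    have "(\<lambda>x. enn2real (\<integral>\<^sup>+y. (\<lambda>(x, y). ennreal (u y)) (x, y) \<partial>K x)) \<in> borel_measurable X"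
      by (intro borel_measurable_enn2real measurable_nn_integral_subprob_kernel[OF K]) measurable
    moreover have "enn2real (\<integral>\<^sup>+y. ennreal (u y) \<partial>K x) = (\<integral>y. u y \<partial>K x)" if x: "x \<in> space X" for x
    proof -
      have [measurable_cong]: "sets (K x) = sets Y"
        using K x by (simp add: subprob_kernel_iff is_kernel_sets[of X Y])
      show ?thesis
        by (rule integral_eq_nn_integral[symmetric]) (use u0 in auto)
    qed
    ultimately show ?thesis
      by (subst measurable_cong) auto
  qed
  define \<phi> where "\<phi> j x = (\<integral>y. (g j y)\<^sup>2 \<partial>k x) - 2 * (\<integral>y. g j y \<partial>l x)" for j x
  have \<phi>_meas [measurable]: "\<phi> j \<in> borel_measurable X" for j
    unfolding \<phi>_def
    by (intro borel_measurable_diff borel_measurable_times borel_measurable_const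
        int_meas[OF k] int_meas[OF l]) (use g01 in auto)
  \<comment> \<open>This will equal \<open>- H\<close>, where \<open>H\<close> is the squared norm
    of the derivative at x. As an infimum of countably many measurable functions it is measurable in
    x, although the derivative itself is chosen pointwise.\<close>
  define I where "I x = (INF j. \<phi> j x)" for x
  have I_meas [measurable]: "I \<in> borel_measurable X"
    unfolding I_def by (rule borel_measurable_cINF_real) auto
  \<comment> \<open>The least admissible index makes the selection measurable. The tolerances are
    summable, so that the selected functions converge almost everywhere without passing to a
    subsequence.\<close>
  define J where "J n x = (LEAST j. \<phi> j x < I x + (1 / 2) ^ n)" for n :: nat and x
  have J_meas [measurable]: "J n \<in> measurable X (count_space UNIV)" for n
    unfolding J_def by measurable
  define F where "F n p = g (J n (fst p)) (snd p)" for n p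
  have F_meas [measurable]: "F n \<in> borel_measurable (X \<Otimes>\<^sub>M Y)" for n
    unfolding F_def
    by (rule measurable_compose_countable[of "\<lambda>j p. g j (snd p)" _ _ "\<lambda>p. J n (fst p)"]) measurable
  \<comment> \<open>The limsup is defined and measurable everywhere, and it is the limit wherever
    that exists.\<close>
  define f where "f p = limsup (\<lambda>n. ennreal (F n p))" for p
  have f_meas [measurable]: "f \<in> borel_measurable (X \<Otimes>\<^sub>M Y)"
    unfolding f_def by measurable
  show thesis
  proof
    fix x assume x: "x \<in> space X"
    note [measurable_cong] = is_kernel_sets[OF ker(1) x] is_kernel_sets[OF ker(2) x]
    interpret finite_measure "k x"
      using subprob_kernel_finite_measure[OF k x] .
    obtain h :: "'b \<Rightarrow> real" where h [measurable]: "h \<in> borel_measurable (k x)"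
      and h01: "\<And>y. 0 \<le> h y \<and> h y \<le> 1" and h_l: "density (k x) (\<lambda>y. ennreal (h y)) = l x"
      using le[OF x] dominated_density_le_1[of "l x"] is_kernel_sets[OF ker(1) x]
        is_kernel_sets[OF ker(2) x] by metis
    define H where "H = (\<integral>y. (h y)\<^sup>2 \<partial>k x)"
    have bound_int: "integrable (k x) u"
      if "u \<in> borel_measurable (k x)" "\<And>y. 0 \<le> u y \<and> u y \<le> 1" for u :: "'b \<Rightarrow> real"
      by (rule integrable_const_bound[of _ 1]) (use that in auto)
    have sq01: "0 \<le> u\<^sup>2 \<and> u\<^sup>2 \<le> 1" if "-1 \<le> u \<and> u \<le> 1" for u :: real
      using that by (simp add: abs_square_le_1 abs_le_iff)
    have dist: "(\<integral>y. (h y - g j y)\<^sup>2 \<partial>k x) = H + \<phi> j x" for j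
    proof -
      have ints: "integrable (k x) (\<lambda>y. (h y)\<^sup>2)" "integrable (k x) (\<lambda>y. (g j y)\<^sup>2)"
        "integrable (k x) (\<lambda>y. h y * g j y)"
        using h01 g01 by (auto intro!: bound_int mult_le_one power_le_one)
      have "(\<integral>y. g j y \<partial>l x) = (\<integral>y. h y * g j y \<partial>k x)"
        unfolding h_l[symmetric] using h01 by (subst integral_density) auto
      moreover have "(\<integral>y. (h y - g j y)\<^sup>2 \<partial>k x)
          = (\<integral>y. ((h y)\<^sup>2 + (g j y)\<^sup>2) - 2 * (h y * g j y) \<partial>k x)"
        by (intro Bochner_Integration.integral_cong) (auto simp: power2_diff)
      moreover have "\<dots> = H + (\<integral>y. (g j y)\<^sup>2 \<partial>k x) - 2 * (\<integral>y. h y * g j y \<partial>k x)"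
        using ints by (simp add: H_def)
      ultimately show ?thesis by (simp add: \<phi>_def)
    qed
    have \<phi>_ge: "- H \<le> \<phi> j x" for j
      using dist[of j] Bochner_Integration.integral_nonneg[of "k x" "\<lambda>y. (h y - g j y)\<^sup>2"] by simp
    have \<phi>_approx: "\<exists>j. \<phi> j x < - H + e" if "e > 0" for e
    proof -
      have "\<exists>u\<in>rational_steps E. (\<integral>y. (h y - max 0 (min 1 (u y)))\<^sup>2 \<partial>k x) < e"
        using E is_kernel_sets[OF ker(1) x] is_kernel_space[OF ker(1) x]
        by (intro square_approx_rational_steps h h01 that) simp_all
      then obtain v where "v \<in> G" and v: "(\<integral>y. (h y - v y)\<^sup>2 \<partial>k x) < e"
        by (auto simp: G_def)
      then obtain j where "v = g j"
        unfolding g_def using G by (metis from_nat_into_surj)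
      with v dist[of j] show ?thesis by (intro exI[of _ j]) simp
    qed
    have I_eq: "I x = - H"
    proof (rule antisym)
      show "- H \<le> I x"
        unfolding I_def by (intro cINF_greatest \<phi>_ge) simp
      show "I x \<le> - H"
      proof (rule field_le_epsilon)
        fix e :: real assume "e > 0"
        then obtain j where "\<phi> j x < - H + e" using \<phi>_approx by blast
        moreover have "I x \<le> \<phi> j x"
          unfolding I_def using \<phi>_ge by (intro cINF_lower bdd_belowI[of _ "- H"]) auto
        ultimately show "I x \<le> - H + e" by simp
      qed
    qed
    have F_dist: "(\<integral>y. (h y - F n (x, y))\<^sup>2 \<partial>k x) < (1 / 2) ^ n" for n
    proof -
      have "\<exists>j. \<phi> j x < I x + (1 / 2) ^ n"
        using \<phi>_approx[of "(1 / 2) ^ n"] I_eq by simp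
      then have "\<phi> (J n x) x < I x + (1 / 2) ^ n"
        unfolding J_def by (rule LeastI_ex)
      then show ?thesis
        using dist[of "J n x"] by (simp add: F_def I_eq)
    qed
    have F_sec [measurable]: "(\<lambda>y. F n (x, y)) \<in> borel_measurable (k x)" for n
      using x by measurable
    \<comment> \<open>The squared errors have a finite integrated sum, so for almost every y their
      series converges and its terms tend to 0.\<close>
    have "(\<integral>\<^sup>+y. (\<Sum>n. ennreal ((h y - F n (x, y))\<^sup>2)) \<partial>k x)
        = (\<Sum>n. \<integral>\<^sup>+y. ennreal ((h y - F n (x, y))\<^sup>2) \<partial>k x)"
      by (rule nn_integral_suminf) measurable
    also have "\<dots> \<le> (\<Sum>n. ennreal ((1 / 2) ^ n))"
    proof (intro suminf_le summableI)
      fix n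
      have "integrable (k x) (\<lambda>y. (h y - F n (x, y))\<^sup>2)"
      proof (intro bound_int sq01)
        show "- 1 \<le> h y - F n (x, y) \<and> h y - F n (x, y) \<le> 1" for y
          using h01[of y] g01[of "J n x" y] by (auto simp: F_def)
      qed measurable
      then have "(\<integral>\<^sup>+y. ennreal ((h y - F n (x, y))\<^sup>2) \<partial>k x) = ennreal (\<integral>y. (h y - F n (x, y))\<^sup>2 \<partial>k x)"
        by (intro nn_integral_eq_integral) auto
      also have "\<dots> \<le> ennreal ((1 / 2) ^ n)"
        using F_dist[of n] by (intro ennreal_leI) simp
      finally show "(\<integral>\<^sup>+y. ennreal ((h y - F n (x, y))\<^sup>2) \<partial>k x) \<le> ennreal ((1 / 2) ^ n)" .
    qed
    also have "\<dots> < \<infinity>"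
      by (subst suminf_ennreal2) (auto simp: summable_geometric)
    finally have "AE y in k x. (\<Sum>n. ennreal ((h y - F n (x, y))\<^sup>2)) \<noteq> \<infinity>"
      by (intro nn_integral_PInf_AE) auto
    then have "AE y in k x. f (x, y) = ennreal (h y)"
    proof eventually_elim
      case (elim y)
      then have "summable (\<lambda>n. (h y - F n (x, y))\<^sup>2)"
        by (intro summable_suminf_not_top) auto
      then have "(\<lambda>n. sqrt ((h y - F n (x, y))\<^sup>2)) \<longlonglongrightarrow> sqrt 0"
        by (intro tendsto_real_sqrt summable_LIMSEQ_zero)
      then have "(\<lambda>n. h y - F n (x, y)) \<longlonglongrightarrow> 0"
        by (simp add: tendsto_rabs_zero_iff)
      then have "(\<lambda>n. h y - (h y - F n (x, y))) \<longlonglongrightarrow> h y - 0"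
        by (intro tendsto_diff tendsto_const)
      then have "(\<lambda>n. ennreal (F n (x, y))) \<longlonglongrightarrow> ennreal (h y)"
        by (intro tendsto_ennrealI) simp
      then show ?case
        unfolding f_def by (intro lim_imp_Limsup) auto
    qed
    then have "density (k x) (\<lambda>y. f (x, y)) = density (k x) (\<lambda>y. ennreal (h y))"
      using x by (intro density_cong) measurable
    then show "density (k x) (\<lambda>y. f (x, y)) = l x"
      by (simp only: h_l)
  qed (rule f_meas)
qed

section \<open>Domination of an s-finite kernel by a subprobability kernel\<close>

text \<open>The weights 2^(-n-1) sum to 1, which bounds the mass of \<open>\<mu>\<close>, and are
  positive, which equates the null sets. The scaled pieces \<open>ls n\<close> are kept because each
  is a summand of \<open>\<mu>\<close> and so dominated by it with constant 1; the factors 2^(n+1)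
  recover \<open>\<nu>\<close>.\<close>

lemma s_finite_kernel_dominating:
  assumes \<nu>: "s_finite_kernel X Y \<nu>"
  obtains \<mu> ls where "subprob_kernel X Y \<mu>" "\<forall>n. subprob_kernel X Y (ls n)"
    "\<forall>n. \<forall>x\<in>space X. \<forall>V\<in>sets Y. emeasure (ls n x) V \<le> emeasure (\<mu> x) V"
    "\<forall>x\<in>space X. \<forall>V\<in>sets Y.
       emeasure (\<nu> x) V = (\<Sum>n. ennreal (2 ^ Suc n) * emeasure (ls n x) V)"
    "\<forall>x\<in>space X. \<forall>V\<in>sets Y. emeasure (\<mu> x) V = 0 \<longleftrightarrow> emeasure (\<nu> x) V = 0"
proof -
  obtain \<nu>s where \<nu>s: "\<And>n. subprob_kernel X Y (\<nu>s n)" and sum: "is_kernel_sum X Y \<nu> \<nu>s"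
    using s_finite_kernelD[OF \<nu>] by blast
  define ls where "ls n x = scale_measure (ennreal ((1 / 2) ^ Suc n)) (\<nu>s n x)" for n x
  define \<mu> where "\<mu> x = sum_measure Y (\<lambda>n. ls n x)" for x
  have ker: "is_kernel X Y (\<nu>s n)" and sub: "x \<in> space X \<Longrightarrow> emeasure (\<nu>s n x) (space Y) \<le> 1" for n x
    using \<nu>s[of n] by (auto simp: subprob_kernel_iff)
  have ls: "is_kernel X Y (ls n)" for n
    using is_kernel_scale[OF ker] unfolding ls_def .
  have em_\<mu>: "emeasure (\<mu> x) V = (\<Sum>n. emeasure (ls n x) V)" if "x \<in> space X" "V \<in> sets Y" for x V
    unfolding \<mu>_def using that is_kernel_sets[OF ls] by (intro emeasure_sum_measure) auto
  have le: "emeasure (ls n x) V \<le> emeasure (\<mu> x) V" if "x \<in> space X" "V \<in> sets Y" for n x V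
    unfolding em_\<mu>[OF that] using sum_le_suminf[of "\<lambda>n. emeasure (ls n x) V" "{n}"] by simp
  have em_\<nu>: "emeasure (\<nu> x) V = (\<Sum>n. ennreal (2 ^ Suc n) * emeasure (ls n x) V)"
    if "x \<in> space X" "V \<in> sets Y" for x V
  proof -
    have "ennreal (2 ^ Suc n) * ennreal ((1 / 2) ^ Suc n) = 1" for n
      by (subst ennreal_mult[symmetric]) (simp_all flip: power_mult_distrib)
    then have "ennreal (2 ^ Suc n) * emeasure (ls n x) V = emeasure (\<nu>s n x) V" for n
      by (simp add: ls_def flip: mult.assoc del: power_Suc)
    then show ?thesis
      using sum that by (simp add: is_kernel_sum_def)
  qed
  have "is_kernel X Y \<mu>"
    by (rule is_kernel_of_sum[of X \<mu> Y ls]) (auto simp: \<mu>_def[abs_def] is_kernel_sum_def em_\<mu>[unfolded \<mu>_def] ls)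
  moreover have "emeasure (\<mu> x) (space Y) \<le> 1" if x: "x \<in> space X" for x
  proof -
    have "emeasure (\<mu> x) (space Y) \<le> (\<Sum>n. ennreal ((1 / 2) ^ Suc n))"
      unfolding em_\<mu>[OF x sets.top]
    proof (intro suminf_le summableI)
      fix n
      show "emeasure (ls n x) (space Y) \<le> ennreal ((1 / 2) ^ Suc n)"
        using mult_left_mono[OF sub[OF x], of "ennreal ((1 / 2) ^ Suc n)" n]
        by (simp add: ls_def del: power_Suc)
    qed
    also have "\<dots> = ennreal 1"
      by (intro suminf_ennreal_eq power_half_series) simp
    finally show ?thesis by simp
  qed
  ultimately have \<mu>: "subprob_kernel X Y \<mu>"
    by (simp add: subprob_kernel_iff)
  have sub_ls: "subprob_kernel X Y (ls n)" for n
    using \<mu> ls order_trans[OF le] unfolding subprob_kernel_iff by blast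
  have null: "emeasure (\<mu> x) V = 0 \<longleftrightarrow> emeasure (\<nu> x) V = 0" if "x \<in> space X" "V \<in> sets Y" for x V
    unfolding em_\<mu>[OF that] em_\<nu>[OF that] by (simp add: suminf_eq_zero_iff)
  show thesis
    by (rule that[OF \<mu>, of ls]; intro allI ballI sub_ls le em_\<nu> null)
qed

text \<open>N has no mass where its density vanishes, and equality of null sets transfers this to M.
  The value 0 can then be replaced by 1 without changing the measure.\<close>

lemma density_zero_null:
  assumes sets: "sets M = sets Y" and f: "f \<in> borel_measurable Y" and N: "N = density M f"
    and null: "\<And>V. V \<in> sets Y \<Longrightarrow> emeasure M V = 0 \<longleftrightarrow> emeasure N V = 0"
  shows "emeasure M {y \<in> space Y. f y = 0} = 0"
    and "N = density M (\<lambda>y. if f y = 0 then 1 else f y)"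
proof -
  note [measurable_cong] = sets
  note [measurable] = f
  have Z [measurable]: "{y \<in> space Y. f y = 0} \<in> sets Y"
    by measurable
  have "emeasure N {y \<in> space Y. f y = 0} = (\<integral>\<^sup>+y. f y * indicator {y \<in> space Y. f y = 0} y \<partial>M)"
    unfolding N using Z sets by (intro emeasure_density) auto
  also have "\<dots> = (\<integral>\<^sup>+y. 0 \<partial>M)"
    by (intro nn_integral_cong) (auto simp: indicator_def)
  finally show 0: "emeasure M {y \<in> space Y. f y = 0} = 0"
    using null[OF Z] by simp
  have "AE y in M. f y \<noteq> 0"
    by (rule AE_I[OF _ 0]) (use sets sets_eq_imp_space_eq[OF sets] Z in auto)
  then have "density M f = density M (\<lambda>y. if f y = 0 then 1 else f y)"
    by (intro density_cong) auto
  then show "N = density M (\<lambda>y. if f y = 0 then 1 else f y)"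
    by (simp add: N)
qed

text \<open>Monotone convergence; it reassembles \<open>\<nu> x\<close> from the derivatives of its
  pieces.\<close>

lemma emeasure_density_suminf:
  assumes sets: "sets M = sets Y" and h [measurable]: "\<And>n::nat. h n \<in> borel_measurable Y"
    and V: "V \<in> sets Y"
  shows "emeasure (density M (\<lambda>y. \<Sum>n. c n * h n y)) V = (\<Sum>n. c n * emeasure (density M (h n)) V)"
proof -
  note [measurable_cong] = sets
  note [measurable] = V
  have "emeasure (density M (\<lambda>y. \<Sum>n. c n * h n y)) V
      = (\<integral>\<^sup>+y. (\<Sum>n. c n * h n y) * indicator V y \<partial>M)"
    using V sets by (intro emeasure_density) auto
  also have "\<dots> = (\<integral>\<^sup>+y. (\<Sum>n. c n * (h n y * indicator V y)) \<partial>M)"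
    by (simp only: ennreal_suminf_multc[symmetric] mult.assoc)
  also have "\<dots> = (\<Sum>n. \<integral>\<^sup>+y. c n * (h n y * indicator V y) \<partial>M)"
    by (intro nn_integral_suminf) measurable
  also have "\<dots> = (\<Sum>n. c n * (\<integral>\<^sup>+y. h n y * indicator V y \<partial>M))"
    by (intro suminf_cong nn_integral_cmult) measurable
  also have "\<dots> = (\<Sum>n. c n * emeasure (density M (h n)) V)"
    using V sets by (intro suminf_cong arg_cong2[where f="(*)"] emeasure_density[symmetric]) auto
  finally show ?thesis .
qed

lemma s_finite_kernel_eq_density:
  assumes \<nu>: "s_finite_kernel X Y \<nu>"
  obtains \<mu> f where "subprob_kernel X Y \<mu>"
    "\<forall>x\<in>space X. (\<lambda>y. f (x, y)) \<in> borel_measurable Y"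
    "kernel_eq X \<nu> (kernel_density \<mu> f)"
    "\<forall>x\<in>space X. \<forall>V\<in>sets Y. emeasure (\<mu> x) V = 0 \<longleftrightarrow> emeasure (\<nu> x) V = 0"
    "countable_discrete X \<or> standard_borel Y \<longrightarrow> f \<in> borel_measurable (X \<Otimes>\<^sub>M Y)"
proof -
  obtain \<mu> ls where \<mu>: "subprob_kernel X Y \<mu>" and ls: "\<forall>n. subprob_kernel X Y (ls n)"
    and le: "\<forall>n. \<forall>x\<in>space X. \<forall>V\<in>sets Y. emeasure (ls n x) V \<le> emeasure (\<mu> x) V"
    and em_\<nu>: "\<forall>x\<in>space X. \<forall>V\<in>sets Y.
       emeasure (\<nu> x) V = (\<Sum>n. ennreal (2 ^ Suc n) * emeasure (ls n x) V)"
    and null: "\<forall>x\<in>space X. \<forall>V\<in>sets Y. emeasure (\<mu> x) V = 0 \<longleftrightarrow> emeasure (\<nu> x) V = 0"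
    by (rule s_finite_kernel_dominating[OF \<nu>])
  have ker: "is_kernel X Y \<mu>" "is_kernel X Y \<nu>"
    using \<mu> \<nu> by (simp_all add: subprob_kernel_iff s_finite_kernel_def)
  show thesis
  proof (cases "standard_borel Y")
    case True
    then obtain E where E: "countable E" "Int_stable E" "E \<subseteq> Pow (space Y)" "space Y \<in> E"
      "sets Y = sigma_sets (space Y) E"
      by (rule standard_borel_countable_generator)
    have "\<exists>h. h \<in> borel_measurable (X \<Otimes>\<^sub>M Y) \<and>
        (\<forall>x\<in>space X. density (\<mu> x) (\<lambda>y. h (x, y)) = ls n x)" for n
      using jointly_measurable_density[OF \<mu> ls[rule_format] le[rule_format] E, of n] by metis
    then obtain h where h [measurable]: "\<And>n. h n \<in> borel_measurable (X \<Otimes>\<^sub>M Y)"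
      and h_ls: "\<And>n x. x \<in> space X \<Longrightarrow> density (\<mu> x) (\<lambda>y. h n (x, y)) = ls n x"
      by metis
    \<comment> \<open>The coefficients undo the weights inside \<open>ls n\<close>. The series may
      diverge, and then f takes the value \<open>\<infinity>\<close>.\<close>
    define f where "f p = (\<Sum>n. ennreal (2 ^ Suc n) * h n p)" for p
    have f: "f \<in> borel_measurable (X \<Otimes>\<^sub>M Y)"
      unfolding f_def by measurable
    have "\<nu> x = kernel_density \<mu> f x" if x: "x \<in> space X" for x
    proof (rule measure_eqI)
      show "sets (\<nu> x) = sets (kernel_density \<mu> f x)"
        using x ker by (simp add: kernel_density_def is_kernel_sets[of X Y])
      fix V assume "V \<in> sets (\<nu> x)"
      then have V: "V \<in> sets Y"
        using ker(2) x by (simp add: is_kernel_sets[of X Y])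
      have h_sec: "(\<lambda>y. h n (x, y)) \<in> borel_measurable Y" for n
        using x by measurable
      show "emeasure (\<nu> x) V = emeasure (kernel_density \<mu> f x) V"
        unfolding kernel_density_def f_def
        by (simp only: emeasure_density_suminf[OF is_kernel_sets[OF ker(1) x] h_sec V]
            h_ls[OF x] em_\<nu>[rule_format, OF x V])
    qed
    with f \<mu> null show thesis
      by (intro that[of \<mu> f]) (auto simp: kernel_eq_def)
  next
    case False
    \<comment> \<open>\<open>\<nu> x\<close> may fail to be sigma-finite; this form of Radon-Nikodym
      asks finiteness of the reference measure \<open>\<mu> x\<close> and admits derivatives with
      infinite values.\<close>
    have "\<exists>h\<in>borel_measurable Y. density (\<mu> x) h = \<nu> x" if x: "x \<in> space X" for x
    proof -
      interpret finite_measure "\<mu> x"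
        using subprob_kernel_finite_measure[OF \<mu> x] .
      have sets: "sets (\<mu> x) = sets Y" "sets (\<nu> x) = sets Y"
        using ker x by (simp_all add: is_kernel_sets[of X Y])
      have "absolutely_continuous (\<mu> x) (\<nu> x)"
        using null x by (auto simp: absolutely_continuous_def null_sets_def sets)
      then show ?thesis
        using Radon_Nikodym_finite_measure_infinite[of "\<nu> x"] sets
        by (simp cong: measurable_cong_sets)
    qed
    then obtain h where h: "\<And>x. x \<in> space X \<Longrightarrow> h x \<in> borel_measurable Y"
      and h_\<nu>: "\<And>x. x \<in> space X \<Longrightarrow> density (\<mu> x) (h x) = \<nu> x"
      by metis
    \<comment> \<open>Countably many measurable sections over a discrete space fit together
      measurably, whatever was chosen at each x.\<close>
    have "case_prod h \<in> borel_measurable (X \<Otimes>\<^sub>M Y)" if "countable_discrete X"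
    proof -
      have X: "countable (space X)" "sets X = sets (count_space (space X))"
        using that by (simp_all add: countable_discrete_def)
      have "case_prod h \<in> borel_measurable (count_space (space X) \<Otimes>\<^sub>M Y)"
        using X(1) h by (intro measurable_pair_measure_countable1) auto
      then show ?thesis
        by (simp add: measurable_cong_sets[OF sets_pair_measure_cong[OF X(2) refl] refl])
    qed
    with False h h_\<nu> \<mu> null show thesis
      by (intro that[of \<mu> "case_prod h"]) (auto simp: kernel_eq_def kernel_density_def)
  qed
qed

lemma s_finite_kernel_eq_nonvanishing_density:
  assumes \<nu>: "s_finite_kernel X Y \<nu>"
  obtains \<mu> f f' where "subprob_kernel X Y \<mu>"
    "\<forall>x\<in>space X. (\<lambda>y. f (x, y)) \<in> borel_measurable Y"
    "kernel_eq X \<nu> (kernel_density \<mu> f)"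
    "\<forall>x\<in>space X. emeasure (\<mu> x) {y \<in> space Y. f (x, y) = 0} = 0"
    "\<forall>x\<in>space X. (\<lambda>y. f' (x, y)) \<in> borel_measurable Y"
    "kernel_eq X \<nu> (kernel_density \<mu> f')" "\<forall>p. f' p > 0"
    "countable_discrete X \<or> standard_borel Y \<longrightarrow>
       f \<in> borel_measurable (X \<Otimes>\<^sub>M Y) \<and> f' \<in> borel_measurable (X \<Otimes>\<^sub>M Y)"
proof -
  obtain \<mu> f where \<mu>: "subprob_kernel X Y \<mu>"
    and f: "\<forall>x\<in>space X. (\<lambda>y. f (x, y)) \<in> borel_measurable Y"
    and \<nu>_eq: "kernel_eq X \<nu> (kernel_density \<mu> f)"
    and null: "\<forall>x\<in>space X. \<forall>V\<in>sets Y. emeasure (\<mu> x) V = 0 \<longleftrightarrow> emeasure (\<nu> x) V = 0"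
    and joint: "countable_discrete X \<or> standard_borel Y \<longrightarrow> f \<in> borel_measurable (X \<Otimes>\<^sub>M Y)"
    by (rule s_finite_kernel_eq_density[OF \<nu>])
  define f' where "f' p = (if f p = 0 then 1 else f p)" for p
  have sets: "sets (\<mu> x) = sets Y" if "x \<in> space X" for x
    using \<mu> that by (simp add: subprob_kernel_iff is_kernel_sets[of X Y])
  have N: "\<nu> x = density (\<mu> x) (\<lambda>y. f (x, y))" if "x \<in> space X" for x
    using \<nu>_eq that by (simp add: kernel_eq_def kernel_density_def)
  note zero = density_zero_null[OF sets f[rule_format] N null[rule_format]]
  show thesis
  proof (rule that[OF \<mu> f \<nu>_eq, of f'])
    show "\<forall>x\<in>space X. emeasure (\<mu> x) {y \<in> space Y. f (x, y) = 0} = 0"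
      using zero(1) by blast
    show "\<forall>x\<in>space X. (\<lambda>y. f' (x, y)) \<in> borel_measurable Y"
    proof
      fix x assume "x \<in> space X"
      then have [measurable]: "(\<lambda>y. f (x, y)) \<in> borel_measurable Y"
        using f by blast
      show "(\<lambda>y. f' (x, y)) \<in> borel_measurable Y"
        unfolding f'_def by measurable
    qed
    show "kernel_eq X \<nu> (kernel_density \<mu> f')"
      unfolding kernel_eq_def kernel_density_def f'_def using zero(2) by blast
    show "\<forall>p. f' p > 0"
      by (simp add: f'_def zero_less_iff_neq_zero)
    show "countable_discrete X \<or> standard_borel Y \<longrightarrow>
        f \<in> borel_measurable (X \<Otimes>\<^sub>M Y) \<and> f' \<in> borel_measurable (X \<Otimes>\<^sub>M Y)"
    proof
      assume "countable_discrete X \<or> standard_borel Y"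
      with joint have [measurable]: "f \<in> borel_measurable (X \<Otimes>\<^sub>M Y)" by blast
      show "f \<in> borel_measurable (X \<Otimes>\<^sub>M Y) \<and> f' \<in> borel_measurable (X \<Otimes>\<^sub>M Y)"
        unfolding f'_def by measurable
    qed
  qed
qed

text \<open>The equivalence with pushforwards names the carrier type \<open>nat \<times> 'b\<close>
  of the constructed W; the separate implication for W over \<open>'w\<close> gives the converse for
  spaces of any type. In the last two conjuncts one \<open>\<mu>\<close> serves both the density
  with null zero set and the strictly positive one.\<close>

theorem theorem5:
  fixes X :: "'a measure" and Y :: "'b measure" and \<nu> :: "'a \<Rightarrow> 'b measure"
  assumes "is_kernel X Y \<nu>"
  shows
    "(s_finite_kernel X Y \<nu> \<longleftrightarrow>
        (\<exists>\<nu>s. (\<forall>n::nat. subprob_kernel X Y (\<nu>s n)) \<and> is_kernel_sum X Y \<nu> \<nu>s)) \<and>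
     (s_finite_kernel X Y \<nu> \<longleftrightarrow>
        (\<exists>W :: (nat \<times> 'b) measure. pushforward_of_sigma_finite W X Y \<nu>)) \<and>
     (\<forall>W :: 'w measure. pushforward_of_sigma_finite W X Y \<nu> \<longrightarrow> s_finite_kernel X Y \<nu>) \<and>
     (\<forall>f \<in> borel_measurable (X \<Otimes>\<^sub>M Y).
        (s_finite_kernel X Y \<nu> \<longrightarrow> s_finite_kernel X Y (kernel_density \<nu> f)) \<and>
        (subprob_kernel X Y \<nu> \<longrightarrow> s_finite_kernel X Y (kernel_density \<nu> f))) \<and>
     (s_finite_kernel X Y \<nu> \<longrightarrow>
        (\<exists>\<mu>. subprob_kernel X Y \<mu> \<and>
           (\<exists>f. (\<forall>x\<in>space X. (\<lambda>y. f (x, y)) \<in> borel_measurable Y) \<and>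
                kernel_eq X \<nu> (kernel_density \<mu> f) \<and>
                (\<forall>x\<in>space X. emeasure (\<mu> x) {y \<in> space Y. f (x, y) = 0} = 0)) \<and>
           (\<exists>f. (\<forall>x\<in>space X. (\<lambda>y. f (x, y)) \<in> borel_measurable Y) \<and>
                kernel_eq X \<nu> (kernel_density \<mu> f) \<and>
                (\<forall>x\<in>space X. \<forall>y\<in>space Y. f (x, y) > 0)))) \<and>
     (s_finite_kernel X Y \<nu> \<and> (countable_discrete X \<or> standard_borel Y) \<longrightarrow>
        (\<exists>\<mu>. subprob_kernel X Y \<mu> \<and>
           (\<exists>f \<in> borel_measurable (X \<Otimes>\<^sub>M Y).
                kernel_eq X \<nu> (kernel_density \<mu> f) \<and>
                (\<forall>x\<in>space X. emeasure (\<mu> x) {y \<in> space Y. f (x, y) = 0} = 0)) \<and>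
           (\<exists>f \<in> borel_measurable (X \<Otimes>\<^sub>M Y).
                kernel_eq X \<nu> (kernel_density \<mu> f) \<and>
                (\<forall>x\<in>space X. \<forall>y\<in>space Y. f (x, y) > 0))))"
  (is "(?S \<longleftrightarrow> ?sum) \<and> (?S \<longleftrightarrow> ?push) \<and> ?push' \<and> ?dens \<and> ?factor \<and> ?joint")
proof (intro conjI)
  have sets: "\<And>x. x \<in> space X \<Longrightarrow> sets (\<nu> x) = sets Y"
    using assms by (rule is_kernel_sets)
  show "?S \<longleftrightarrow> ?sum"
    using s_finite_kernelD s_finite_kernelI[of X \<nu> Y, OF sets] by blast
  show "?S \<longleftrightarrow> ?push"
    using pushforward_sigma_finite_of_s_finite s_finite_pushforward_sigma_finite[OF assms] by blast
  show ?push'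
    using s_finite_pushforward_sigma_finite[OF assms] by blast
  have "?S" if "subprob_kernel X Y \<nu>"
    using that assms finite_kernel_eq_sum_subprob[OF subprob_kernel_finite] s_finite_kernelI[of X \<nu> Y, OF sets]
    by blast
  then show ?dens
    using s_finite_kernel_density by blast
  show ?factor
  proof
    assume ?S
    then obtain \<mu> f f' where "subprob_kernel X Y \<mu>"
      "\<forall>x\<in>space X. (\<lambda>y. f (x, y)) \<in> borel_measurable Y"
      "kernel_eq X \<nu> (kernel_density \<mu> f)"
      "\<forall>x\<in>space X. emeasure (\<mu> x) {y \<in> space Y. f (x, y) = 0} = 0"
      "\<forall>x\<in>space X. (\<lambda>y. f' (x, y)) \<in> borel_measurable Y"
      "kernel_eq X \<nu> (kernel_density \<mu> f')" "\<forall>p. f' p > 0"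
      by (rule s_finite_kernel_eq_nonvanishing_density)
    then show "\<exists>\<mu>. subprob_kernel X Y \<mu> \<and>
           (\<exists>f. (\<forall>x\<in>space X. (\<lambda>y. f (x, y)) \<in> borel_measurable Y) \<and>
                kernel_eq X \<nu> (kernel_density \<mu> f) \<and>
                (\<forall>x\<in>space X. emeasure (\<mu> x) {y \<in> space Y. f (x, y) = 0} = 0)) \<and>
           (\<exists>f. (\<forall>x\<in>space X. (\<lambda>y. f (x, y)) \<in> borel_measurable Y) \<and>
                kernel_eq X \<nu> (kernel_density \<mu> f) \<and>
                (\<forall>x\<in>space X. \<forall>y\<in>space Y. f (x, y) > 0))"
      by (intro exI[of _ \<mu>] conjI exI[of _ f] exI[of _ f']) auto
  qed
  show ?joint
  proof
    assume S: "?S \<and> (countable_discrete X \<or> standard_borel Y)"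
    then have ?S ..
    then obtain \<mu> f f' where "subprob_kernel X Y \<mu>"
      "kernel_eq X \<nu> (kernel_density \<mu> f)"
      "\<forall>x\<in>space X. emeasure (\<mu> x) {y \<in> space Y. f (x, y) = 0} = 0"
      "kernel_eq X \<nu> (kernel_density \<mu> f')" "\<forall>p. f' p > 0"
      "countable_discrete X \<or> standard_borel Y \<longrightarrow>
         f \<in> borel_measurable (X \<Otimes>\<^sub>M Y) \<and> f' \<in> borel_measurable (X \<Otimes>\<^sub>M Y)"
      by (rule s_finite_kernel_eq_nonvanishing_density)
    with S show "\<exists>\<mu>. subprob_kernel X Y \<mu> \<and>
           (\<exists>f \<in> borel_measurable (X \<Otimes>\<^sub>M Y).
                kernel_eq X \<nu> (kernel_density \<mu> f) \<and>
                (\<forall>x\<in>space X. emeasure (\<mu> x) {y \<in> space Y. f (x, y) = 0} = 0)) \<and>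
           (\<exists>f \<in> borel_measurable (X \<Otimes>\<^sub>M Y).
                kernel_eq X \<nu> (kernel_density \<mu> f) \<and>
                (\<forall>x\<in>space X. \<forall>y\<in>space Y. f (x, y) > 0))"
      by (intro exI[of _ \<mu>] conjI bexI[of _ f] bexI[of _ f']) auto
  qed
qed

end
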